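(* (i) Any morphism in the class of residuated lattices is admissible and fulfills GU and LO. (ii) Any morphism in the class of bounded distributive lattices is admissible and fulfills GU and LO. (iii) Any morphism in a semi-degenerate filtral variety is admissible and fulfills GU and LO. (iv) Any morphism in a semi-degenerate discriminator variety is admissible and fulfills GU and LO.
   Context: A (commutative) residuated lattice is an algebra $(R,\vee,\wedge,\odot,\to,0,1)$ such that $(R,\vee,\wedge,0,1)$ is a bounded lattice, $(R,\odot,1)$ is a commutative monoid and, for all $a,b,c\in R$, $a\leq b\to c$ iff $a\odot b\leq c$. Bounded distributive lattices have the operations $\vee,\wedge,0,1$. A variety $\mathcal{C}$ is semi-degenerate if no non-trivial algebra in $\mathcal{C}$ has a one-element subalgebra. A variety $\mathcal{C}$ is filtral if, for every family $(M_i)_{i\in I}$ of subdirectly irreducible members of $\mathcal{C}$ and every subdirect product $S$ of this family, every congruence of $S$ is of the form $\{(a,b)\in S^2 : \{i\in I : a_i=b_i\}\in F\}$ for some filter $F$ of subsets of $I$. A variety $\mathcal{C}$ is a discriminator variety if there is a ternary term $t$ such that, for every subdirectly irreducible $M$ in $\mathcal{C}$ and all $a,b,c\in M$, $t^M(a,b,c)=a$ if $a\neq b$ and $t^M(a,b,c)=c$ if $a=b$. All these varieties are congruence-distributive, so the (modular) commutator of congruences is the intersection. All algebras are non-empty; morphisms are homomorphisms between members of the class. For an algebra $M$, $\mathrm{Con}(M)$ is its congruence lattice, $\Delta_M$ is the equality relation and $\nabla_M=M^2$. A congruence $\phi\neq\nabla_M$ is prime if, for all $\alpha,\beta\in\mathrm{Con}(M)$,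 $\alpha\cap\beta\subseteq\phi$ implies $\alpha\subseteq\phi$ or $\beta\subseteq\phi$; $\mathrm{Spec}(M)$ is the set of prime congruences of $M$. For a morphism $f:A\to B$ and $\psi\in\mathrm{Con}(B)$, $f^*(\psi)=\{(x,y)\in A^2 : (f(x),f(y))\in\psi\}\in\mathrm{Con}(A)$ and $\mathrm{Ker}(f)=f^*(\Delta_B)$. $f$ is admissible if $f^*(\psi)\in\mathrm{Spec}(A)$ for all $\psi\in\mathrm{Spec}(B)$. An admissible morphism $f:A\to B$ fulfills GU (Going Up) if for all $\phi,\psi\in\mathrm{Spec}(A)$ and $\phi_1\in\mathrm{Spec}(B)$ with $\phi\subseteq\psi$ and $f^*(\phi_1)=\phi$ there is $\psi_1\in\mathrm{Spec}(B)$ with $\phi_1\subseteq\psi_1$ and $f^*(\psi_1)=\psi$; it fulfills LO (Lying Over) if for every $\phi\in\mathrm{Spec}(A)$ with $\mathrm{Ker}(f)\subseteq\phi$ there is $\phi_1\in\mathrm{Spec}(B)$ with $f^*(\phi_1)=\phi$. *)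

theory Defs
  imports "HOL-Library.FuncSet" "HOL-Library.Infinite_Typeclass"
begin

section \<open>Algebras, homomorphisms, congruences\<close>

text \<open>A signature is an arity function \<open>ar :: 'f \<Rightarrow> nat\<close> on a type \<open>'f\<close> of operation symbols.
  The value of \<open>oper M g xs\<close> is only relevant if \<open>length xs = ar g\<close> and \<open>set xs \<subseteq> carrier M\<close>.\<close>

record ('f, 'a) alg =
  carrier :: "'a set"
  oper :: "'f \<Rightarrow> 'a list \<Rightarrow> 'a"

definition is_alg :: "('f \<Rightarrow> nat) \<Rightarrow> ('f, 'a) alg \<Rightarrow> bool" where
  "is_alg ar M \<longleftrightarrow> carrier M \<noteq> {} \<and>
     (\<forall>g xs. length xs = ar g \<and> set xs \<subseteq> carrier M \<longrightarrow> oper M g xs \<in> carrier M)"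

definition homs :: "('f \<Rightarrow> nat) \<Rightarrow> ('f, 'a) alg \<Rightarrow> ('f, 'b) alg \<Rightarrow> ('a \<Rightarrow> 'b) set" where
  "homs ar A B = {h \<in> carrier A \<rightarrow> carrier B.
     \<forall>g xs. length xs = ar g \<and> set xs \<subseteq> carrier A \<longrightarrow> h (oper A g xs) = oper B g (map h xs)}"

definition Con :: "('f \<Rightarrow> nat) \<Rightarrow> ('f, 'a) alg \<Rightarrow> ('a \<times> 'a) set set" where
  "Con ar M = {\<theta>. equiv (carrier M) \<theta> \<and>
     (\<forall>g xs ys. length xs = ar g \<and> length ys = ar g \<and> list_all2 (\<lambda>x y. (x, y) \<in> \<theta>) xs ys
        \<longrightarrow> (oper M g xs, oper M g ys) \<in> \<theta>)}"

abbreviation Delta :: "('f, 'a) alg \<Rightarrow> ('a \<times> 'a) set" where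
  "Delta M \<equiv> Id_on (carrier M)"

abbreviation Nabla :: "('f, 'a) alg \<Rightarrow> ('a \<times> 'a) set" where
  "Nabla M \<equiv> carrier M \<times> carrier M"

definition Spec :: "('f \<Rightarrow> nat) \<Rightarrow> ('f, 'a) alg \<Rightarrow> ('a \<times> 'a) set set" where
  "Spec ar M = {\<phi> \<in> Con ar M. \<phi> \<noteq> Nabla M \<and>
     (\<forall>\<alpha>\<in>Con ar M. \<forall>\<beta>\<in>Con ar M. \<alpha> \<inter> \<beta> \<subseteq> \<phi> \<longrightarrow> \<alpha> \<subseteq> \<phi> \<or> \<beta> \<subseteq> \<phi>)}"


section \<open>Admissibility, Going Up, Lying Over\<close>

definition pullback :: "('f, 'a) alg \<Rightarrow> ('a \<Rightarrow> 'b) \<Rightarrow> ('b \<times> 'b) set \<Rightarrow> ('a \<times> 'a) set" where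
  "pullback A f \<psi> = {(x, y) \<in> carrier A \<times> carrier A. (f x, f y) \<in> \<psi>}"

definition Ker :: "('f, 'a) alg \<Rightarrow> ('f, 'b) alg \<Rightarrow> ('a \<Rightarrow> 'b) \<Rightarrow> ('a \<times> 'a) set" where
  "Ker A B f = pullback A f (Delta B)"

definition admissible ::
  "('f \<Rightarrow> nat) \<Rightarrow> ('f, 'a) alg \<Rightarrow> ('f, 'b) alg \<Rightarrow> ('a \<Rightarrow> 'b) \<Rightarrow> bool" where
  "admissible ar A B f \<longleftrightarrow> (\<forall>\<psi>\<in>Spec ar B. pullback A f \<psi> \<in> Spec ar A)"

definition fulfills_GU ::
  "('f \<Rightarrow> nat) \<Rightarrow> ('f, 'a) alg \<Rightarrow> ('f, 'b) alg \<Rightarrow> ('a \<Rightarrow> 'b) \<Rightarrow> bool" where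
  "fulfills_GU ar A B f \<longleftrightarrow>
     (\<forall>\<phi>\<in>Spec ar A. \<forall>\<psi>\<in>Spec ar A. \<forall>\<phi>1\<in>Spec ar B. \<phi> \<subseteq> \<psi> \<and> pullback A f \<phi>1 = \<phi> \<longrightarrow>
        (\<exists>\<psi>1\<in>Spec ar B. \<phi>1 \<subseteq> \<psi>1 \<and> pullback A f \<psi>1 = \<psi>))"

definition fulfills_LO ::
  "('f \<Rightarrow> nat) \<Rightarrow> ('f, 'a) alg \<Rightarrow> ('f, 'b) alg \<Rightarrow> ('a \<Rightarrow> 'b) \<Rightarrow> bool" where
  "fulfills_LO ar A B f \<longleftrightarrow>
     (\<forall>\<phi>\<in>Spec ar A. Ker A B f \<subseteq> \<phi> \<longrightarrow> (\<exists>\<phi>1\<in>Spec ar B. pullback A f \<phi>1 = \<phi>))"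


section \<open>Residuated lattices and bounded distributive lattices\<close>

definition bounded_lattice_on ::
  "'a set \<Rightarrow> ('a \<Rightarrow> 'a \<Rightarrow> 'a) \<Rightarrow> ('a \<Rightarrow> 'a \<Rightarrow> 'a) \<Rightarrow> 'a \<Rightarrow> 'a \<Rightarrow> bool" where
  "bounded_lattice_on R join meet bt tp \<longleftrightarrow>
     bt \<in> R \<and> tp \<in> R \<and>
     (\<forall>a\<in>R. \<forall>b\<in>R. join a b \<in> R \<and> meet a b \<in> R \<and>
        join a b = join b a \<and> meet a b = meet b a \<and>
        join a (meet a b) = a \<and> meet a (join a b) = a) \<and>
     (\<forall>a\<in>R. \<forall>b\<in>R. \<forall>c\<in>R.
        join (join a b) c = join a (join b c) \<and> meet (meet a b) c = meet a (meet b c)) \<and>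
     (\<forall>a\<in>R. join bt a = a \<and> meet tp a = a)"

datatype rl_sym = RJoin | RMeet | RMult | RImp | RZero | ROne

fun rl_ar :: "rl_sym \<Rightarrow> nat" where
  "rl_ar RZero = 0"
| "rl_ar ROne = 0"
| "rl_ar _ = 2"

text \<open>The order \<open>a \<le> b\<close> of the lattice reduct is written out as \<open>join a b = b\<close>.\<close>

definition residuated_lattice :: "(rl_sym, 'a) alg \<Rightarrow> bool" where
  "residuated_lattice M \<longleftrightarrow>
    (let R = carrier M;
         join = (\<lambda>a b. oper M RJoin [a, b]); meet = (\<lambda>a b. oper M RMeet [a, b]);
         mult = (\<lambda>a b. oper M RMult [a, b]); imp = (\<lambda>a b. oper M RImp [a, b]);
         bt = oper M RZero []; tp = oper M ROne [];
         le = (\<lambda>a b. join a b = b)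
     in bounded_lattice_on R join meet bt tp \<and>
        (\<forall>a\<in>R. \<forall>b\<in>R. mult a b \<in> R \<and> imp a b \<in> R \<and> mult a b = mult b a) \<and>
        (\<forall>a\<in>R. \<forall>b\<in>R. \<forall>c\<in>R. mult (mult a b) c = mult a (mult b c)) \<and>
        (\<forall>a\<in>R. mult a tp = a) \<and>
        (\<forall>a\<in>R. \<forall>b\<in>R. \<forall>c\<in>R. le a (imp b c) \<longleftrightarrow> le (mult a b) c))"

datatype bl_sym = LJoin | LMeet | LZero | LOne

fun bl_ar :: "bl_sym \<Rightarrow> nat" where
  "bl_ar LZero = 0"
| "bl_ar LOne = 0"
| "bl_ar _ = 2"

definition bounded_distributive_lattice :: "(bl_sym, 'a) alg \<Rightarrow> bool" where
  "bounded_distributive_lattice M \<longleftrightarrow>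
    (let R = carrier M;
         join = (\<lambda>a b. oper M LJoin [a, b]); meet = (\<lambda>a b. oper M LMeet [a, b])
     in bounded_lattice_on R join meet (oper M LZero []) (oper M LOne []) \<and>
        (\<forall>a\<in>R. \<forall>b\<in>R. \<forall>c\<in>R. meet a (join b c) = join (meet a b) (meet a c)))"


section \<open>Terms and varieties\<close>

datatype ('f, 'v) trm = Var 'v | App 'f "('f, 'v) trm list"

primrec wf_trm :: "('f \<Rightarrow> nat) \<Rightarrow> ('f, 'v) trm \<Rightarrow> bool" where
  "wf_trm ar (Var x) = True"
| "wf_trm ar (App g ts) = (length ts = ar g \<and> list_all (wf_trm ar) ts)"

primrec trm_vars :: "('f, 'v) trm \<Rightarrow> 'v set" where
  "trm_vars (Var x) = {x}"
| "trm_vars (App g ts) = \<Union> (set (map trm_vars ts))"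

primrec trm_val :: "('f, 'a) alg \<Rightarrow> ('v \<Rightarrow> 'a) \<Rightarrow> ('f, 'v) trm \<Rightarrow> 'a" where
  "trm_val M \<rho> (Var x) = \<rho> x"
| "trm_val M \<rho> (App g ts) = oper M g (map (trm_val M \<rho>) ts)"

text \<open>A variety is the class of all models of a set of identities. HOL cannot quantify over
  all types at once, so classes of algebras are sets of algebras whose carriers are subsets of one
  type \<open>'u\<close>, which is arbitrary but will be required to be infinite. Every family of sets embeds
  into some such \<open>'u\<close>, and the index sets of the families in \<open>filtral\<close> below are subsets of the
  same type (for infinite \<open>'u\<close>, these are enough to represent any algebra of the class
  as a subdirect product of subdirectly irreducible ones, as \<open>'u \<times> 'u\<close> injects into \<open>'u\<close>).\<close>

definition is_variety :: "('f \<Rightarrow> nat) \<Rightarrow> ('f, 'u) alg set \<Rightarrow> bool" where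
  "is_variety ar K \<longleftrightarrow>
     (\<exists>E :: (('f, nat) trm \<times> ('f, nat) trm) set.
        (\<forall>(s, t)\<in>E. wf_trm ar s \<and> wf_trm ar t) \<and>
        K = {M. is_alg ar M \<and>
               (\<forall>(s, t)\<in>E. \<forall>\<rho>. range \<rho> \<subseteq> carrier M \<longrightarrow> trm_val M \<rho> s = trm_val M \<rho> t)})"

definition subuniverse :: "('f \<Rightarrow> nat) \<Rightarrow> ('f, 'a) alg \<Rightarrow> 'a set \<Rightarrow> bool" where
  "subuniverse ar M S \<longleftrightarrow> S \<noteq> {} \<and> S \<subseteq> carrier M \<and>
     (\<forall>g xs. length xs = ar g \<and> set xs \<subseteq> S \<longrightarrow> oper M g xs \<in> S)"

definition semi_degenerate :: "('f \<Rightarrow> nat) \<Rightarrow> ('f, 'u) alg set \<Rightarrow> bool" where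
  "semi_degenerate ar K \<longleftrightarrow>
     (\<forall>M\<in>K. (\<nexists>x. carrier M = {x}) \<longrightarrow> (\<nexists>x. subuniverse ar M {x}))"

text \<open>The projections of a subdirect embedding of \<open>M\<close> have as kernels a family of congruences with
  intersection \<open>\<Delta>\<^sub>M\<close>, and every such family arises in this way; \<open>M\<close> is subdirectly irreducible if
  in each such family one kernel is already \<open>\<Delta>\<^sub>M\<close>. The intersection is taken inside \<open>\<nabla>\<^sub>M\<close>, so that
  the empty family has intersection \<open>\<nabla>\<^sub>M\<close>, and trivial algebras are not subdirectly irreducible.\<close>

definition subdirectly_irreducible :: "('f \<Rightarrow> nat) \<Rightarrow> ('f, 'a) alg \<Rightarrow> bool" where
  "subdirectly_irreducible ar M \<longleftrightarrow>
     (\<forall>\<Theta> \<subseteq> Con ar M. Nabla M \<inter> \<Inter>\<Theta> = Delta M \<longrightarrow> Delta M \<in> \<Theta>)"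

definition product_alg :: "'i set \<Rightarrow> ('i \<Rightarrow> ('f, 'a) alg) \<Rightarrow> ('f, 'i \<Rightarrow> 'a) alg" where
  "product_alg I M = \<lparr>carrier = (\<Pi>\<^sub>E i\<in>I. carrier (M i)),
     oper = (\<lambda>g xs. \<lambda>i\<in>I. oper (M i) g (map (\<lambda>x. x i) xs))\<rparr>"

definition subdirect_product ::
  "('f \<Rightarrow> nat) \<Rightarrow> 'i set \<Rightarrow> ('i \<Rightarrow> ('f, 'a) alg) \<Rightarrow> ('i \<Rightarrow> 'a) set \<Rightarrow> bool" where
  "subdirect_product ar I M S \<longleftrightarrow>
     subuniverse ar (product_alg I M) S \<and> (\<forall>i\<in>I. (\<lambda>x. x i) ` S = carrier (M i))"

text \<open>Filters of subsets of \<open>I\<close> are the library filters below \<open>principal I\<close>; as in the library,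
  a filter may be improper (the case in which the congruence is \<open>\<nabla>\<^sub>S\<close>).\<close>

definition filtral :: "('f \<Rightarrow> nat) \<Rightarrow> ('f, 'u) alg set \<Rightarrow> bool" where
  "filtral ar K \<longleftrightarrow>
     (\<forall>(I :: 'u set) M S.
        (\<forall>i\<in>I. M i \<in> K \<and> subdirectly_irreducible ar (M i)) \<and> subdirect_product ar I M S \<longrightarrow>
        (\<forall>\<theta>\<in>Con ar ((product_alg I M)\<lparr>carrier := S\<rparr>).
           \<exists>F \<le> principal I.
             \<theta> = {(a, b) \<in> S \<times> S. eventually (\<lambda>i. i \<in> I \<and> a i = b i) F}))"

text \<open>A ternary term is a term in the variables 0, 1, 2.\<close>

definition discriminator :: "('f \<Rightarrow> nat) \<Rightarrow> ('f, 'u) alg set \<Rightarrow> bool" where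
  "discriminator ar K \<longleftrightarrow>
     (\<exists>t :: ('f, nat) trm. wf_trm ar t \<and> trm_vars t \<subseteq> {0, 1, 2} \<and>
        (\<forall>M\<in>K. subdirectly_irreducible ar M \<longrightarrow>
           (\<forall>a\<in>carrier M. \<forall>b\<in>carrier M. \<forall>c\<in>carrier M.
              trm_val M ((\<lambda>_. c)(0 := a, 1 := b)) t = (if a \<noteq> b then a else c))))"

end

theory Submission
  imports Defs
begin

text \<open>
  (i) Congruences of a residuated lattice correspond to its filters, and prime ones to prime
  filters. If \<open>P\<close> is a filter of \<open>B\<close> with \<open>f\<inverse>(P) \<subseteq> Q\<close>, then residuation shows that the filter
  generated by \<open>P \<union> f(Q)\<close> is disjoint from \<open>f(A - Q)\<close>, and the prime filter theorem gives a prime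
  filter over \<open>Q\<close>.

  (ii) A prime congruence of a bounded distributive lattice has exactly two classes, a prime filter
  and its complement; so all of them are maximal, and only LO requires the prime filter theorem.

  (iii) In a filtral variety, prime, completely meet irreducible and maximal congruences coincide.
  Let \<open>(\<kappa> i)\<^sub>i\<close> be completely meet irreducible congruences of \<open>A\<close> with intersection below a prime \<open>\<phi>\<close>.
  Then \<open>\<phi>\<close> is induced by a filter on the index set, and a maximal such filter is an ultrafilter,
  because \<open>\<phi>\<close> is prime. Conversely, congruences induced by ultrafilters are maximal. So GU is trivial;
  semi-degeneracy and filtrality of powers make the preimage of a maximal congruence maximal, and LO
  follows by using on \<open>B\<close> the ultrafilter that induces \<open>\<phi>\<close> from the preimages of a family of
  maximal congruences of \<open>B\<close>.

  (iv) Discriminator varieties are filtral.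
\<close>

section \<open>Congruences and quotients\<close>

text \<open>Filtrality speaks only of subdirect products of subdirectly irreducible members. This is
  the obstacle behind (iii): the image of an algebra in such a product is not closed under gluing
  along sets of indices, and its projection to a factor may be too small. Both defects disappear
  when the image is enlarged by all families that agree with one of its elements on a set of a
  filter \<open>W\<close>, since elements may then be altered freely off such a set. With an
  ultrafilter for \<open>W\<close> this makes the induced congruences maximal; with the cofinite
  filter and constant families it treats maps into a simple algebra that are not onto. Congruence
  distributivity is never invoked: that maximal congruences are prime comes from filtrality, by
  splitting an index set in two. Semi-degeneracy serves to keep preimages proper.

  For (i) and (ii) a single lying-over lemma for prime filters of lattice-ordered monoids suffices.
  The two cases differ in how its separation hypothesis is checked: by residuation, or through the
  kernel of the morphism.\<close>

lemma ConI:
  assumes "\<theta> \<subseteq> Nabla M" "\<And>x. x \<in> carrier M \<Longrightarrow> (x, x) \<in> \<theta>"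
    "\<And>x y. (x, y) \<in> \<theta> \<Longrightarrow> (y, x) \<in> \<theta>"
    "\<And>x y z. (x, y) \<in> \<theta> \<Longrightarrow> (y, z) \<in> \<theta> \<Longrightarrow> (x, z) \<in> \<theta>"
    "\<And>g xs ys. length xs = ar g \<Longrightarrow> length ys = ar g \<Longrightarrow>
       list_all2 (\<lambda>x y. (x, y) \<in> \<theta>) xs ys \<Longrightarrow> (oper M g xs, oper M g ys) \<in> \<theta>"
  shows "\<theta> \<in> Con ar M"
  using assms unfolding Con_def equiv_def refl_on_def sym_def trans_def by blast

lemma
  assumes "\<theta> \<in> Con ar M"
  shows Con_subset: "\<theta> \<subseteq> Nabla M"
    and Con_refl: "x \<in> carrier M \<Longrightarrow> (x, x) \<in> \<theta>"
    and Con_sym: "(x, y) \<in> \<theta> \<Longrightarrow> (y, x) \<in> \<theta>"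
    and Con_trans: "(x, y) \<in> \<theta> \<Longrightarrow> (y, z) \<in> \<theta> \<Longrightarrow> (x, z) \<in> \<theta>"
    and Con_oper: "length xs = ar g \<Longrightarrow> length ys = ar g \<Longrightarrow>
       list_all2 (\<lambda>x y. (x, y) \<in> \<theta>) xs ys \<Longrightarrow> (oper M g xs, oper M g ys) \<in> \<theta>"
  using assms unfolding Con_def equiv_def refl_on_def sym_def trans_def by blast+

lemma is_algD:
  assumes "is_alg ar M"
  shows "carrier M \<noteq> {}"
    and "length xs = ar g \<Longrightarrow> set xs \<subseteq> carrier M \<Longrightarrow> oper M g xs \<in> carrier M"
  using assms by (auto simp: is_alg_def)

lemma homsD:
  assumes "h \<in> homs ar A B"
  shows "x \<in> carrier A \<Longrightarrow> h x \<in> carrier B"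
    and "length xs = ar g \<Longrightarrow> set xs \<subseteq> carrier A \<Longrightarrow> h (oper A g xs) = oper B g (map h xs)"
  using assms by (auto simp: homs_def)

lemma hom_comp:
  assumes "f \<in> homs ar A B" "h \<in> homs ar B C"
  shows "h \<circ> f \<in> homs ar A C"
proof -
  have "(h \<circ> f) (oper A g xs) = oper C g (map (h \<circ> f) xs)"
    if "length xs = ar g" "set xs \<subseteq> carrier A" for g xs
    using that homsD[OF assms(1)] homsD(2)[OF assms(2), of "map f xs" g] by force
  then show ?thesis
    using homsD(1)[OF assms(1)] homsD(1)[OF assms(2)] by (auto simp: homs_def)
qed

lemma list_all2_subset:
  assumes "list_all2 (\<lambda>x y. (x, y) \<in> \<theta>) xs ys" "\<theta> \<subseteq> S \<times> S"
  shows "set xs \<subseteq> S" "set ys \<subseteq> S"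
  using assms by (fastforce simp: list_all2_conv_all_nth in_set_conv_nth)+

lemma pullback_Con:
  assumes A: "is_alg ar A" and f: "f \<in> homs ar A B" and \<psi>: "\<psi> \<in> Con ar B"
  shows "pullback A f \<psi> \<in> Con ar A"
proof (rule ConI)
  fix g xs ys
  assume l: "length xs = ar g" "length ys = ar g"
    and r: "list_all2 (\<lambda>x y. (x, y) \<in> pullback A f \<psi>) xs ys"
  have s: "set xs \<subseteq> carrier A" "set ys \<subseteq> carrier A"
    using list_all2_subset[OF r] by (auto simp: pullback_def)
  have "list_all2 (\<lambda>x y. (x, y) \<in> \<psi>) (map f xs) (map f ys)"
    using r by (auto simp: list_all2_conv_all_nth pullback_def)
  then have "(oper B g (map f xs), oper B g (map f ys)) \<in> \<psi>"
    using Con_oper[OF \<psi>] l by simp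
  then show "(oper A g xs, oper A g ys) \<in> pullback A f \<psi>"
    using l s homsD(2)[OF f] is_algD(2)[OF A] by (simp add: pullback_def)
next
  show "(x, z) \<in> pullback A f \<psi>"
    if "(x, y) \<in> pullback A f \<psi>" "(y, z) \<in> pullback A f \<psi>" for x y z
    using that Con_trans[OF \<psi>, of "f x" "f y" "f z"] by (simp add: pullback_def)
qed (auto simp: pullback_def intro: Con_refl[OF \<psi>] Con_sym[OF \<psi>] homsD(1)[OF f])

lemma Delta_Con: "is_alg ar M \<Longrightarrow> Delta M \<in> Con ar M"
proof (rule ConI)
  fix g xs ys
  assume M: "is_alg ar M" and l: "length xs = ar g"
    and r: "list_all2 (\<lambda>x y. (x, y) \<in> Delta M) xs ys"
  have "xs = ys" "set xs \<subseteq> carrier M"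
    using r by (auto simp: list_all2_conv_all_nth in_set_conv_nth list_eq_iff_nth_eq)
  then show "(oper M g xs, oper M g ys) \<in> Delta M"
    using is_algD(2)[OF M l] by auto
qed auto

definition rep :: "('a \<times> 'a) set \<Rightarrow> 'a \<Rightarrow> 'a" where
  "rep \<theta> x = (SOME y. (x, y) \<in> \<theta>)"

text \<open>Classes are represented by chosen elements, so that the quotient of an algebra with carrier in
  \<open>'u\<close> again has its carrier in \<open>'u\<close>.\<close>

definition quot :: "('f, 'a) alg \<Rightarrow> ('a \<times> 'a) set \<Rightarrow> ('f, 'a) alg" where
  "quot M \<theta> = \<lparr>carrier = rep \<theta> ` carrier M, oper = (\<lambda>g xs. rep \<theta> (oper M g xs))\<rparr>"

lemma carrier_quot: "carrier (quot M \<theta>) = rep \<theta> ` carrier M"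
  by (simp add: quot_def)

context
  fixes ar :: "'f \<Rightarrow> nat" and M :: "('f, 'a) alg" and \<theta>
  assumes M: "is_alg ar M" and \<theta>: "\<theta> \<in> Con ar M"
begin

lemma rep_rel: "x \<in> carrier M \<Longrightarrow> (x, rep \<theta> x) \<in> \<theta>"
  unfolding rep_def using Con_refl[OF \<theta>] by (rule someI)

lemma rep_carrier: "x \<in> carrier M \<Longrightarrow> rep \<theta> x \<in> carrier M"
  using rep_rel Con_subset[OF \<theta>] by blast

lemma rep_eq_iff:
  assumes "x \<in> carrier M" "y \<in> carrier M"
  shows "rep \<theta> x = rep \<theta> y \<longleftrightarrow> (x, y) \<in> \<theta>"
proof
  assume "(x, y) \<in> \<theta>"
  then have "(x, z) \<in> \<theta> \<longleftrightarrow> (y, z) \<in> \<theta>" for z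
    using Con_sym[OF \<theta>] Con_trans[OF \<theta>] by blast
  then show "rep \<theta> x = rep \<theta> y"
    by (simp add: rep_def)
qed (metis assms rep_rel Con_sym[OF \<theta>] Con_trans[OF \<theta>])

lemma rep_hom: "rep \<theta> \<in> homs ar M (quot M \<theta>)"
proof -
  have "rep \<theta> (oper M g xs) = rep \<theta> (oper M g (map (rep \<theta>) xs))"
    if "length xs = ar g" "set xs \<subseteq> carrier M" for g xs
  proof -
    have "list_all2 (\<lambda>x y. (x, y) \<in> \<theta>) xs (map (rep \<theta>) xs)"
      using that rep_rel by (auto simp: list_all2_conv_all_nth subset_iff)
    then have "(oper M g xs, oper M g (map (rep \<theta>) xs)) \<in> \<theta>"
      using Con_oper[OF \<theta>] that by simp
    then show ?thesis
      using Con_subset[OF \<theta>] rep_eq_iff by blast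
  qed
  then show ?thesis
    by (auto simp: homs_def quot_def)
qed

lemma quot_alg: "is_alg ar (quot M \<theta>)"
  unfolding is_alg_def
proof (intro conjI allI impI)
  show "carrier (quot M \<theta>) \<noteq> {}"
    using is_algD(1)[OF M] by (simp add: carrier_quot)
  fix g xs
  assume *: "length xs = ar g \<and> set xs \<subseteq> carrier (quot M \<theta>)"
  then have "set xs \<subseteq> carrier M"
    using rep_carrier by (auto simp: carrier_quot)
  then show "oper (quot M \<theta>) g xs \<in> carrier (quot M \<theta>)"
    using * is_algD(2)[OF M] by (auto simp: quot_def)
qed

end

section \<open>Terms, and closure of varieties under quotients\<close>

lemma trm_val_carrier:
  "is_alg ar M \<Longrightarrow> wf_trm ar t \<Longrightarrow> range \<rho> \<subseteq> carrier M \<Longrightarrow> trm_val M \<rho> t \<in> carrier M"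
  by (induction t) (auto simp: list_all_iff intro!: is_algD(2))

lemma trm_val_hom:
  assumes "is_alg ar A" "h \<in> homs ar A B" "range \<rho> \<subseteq> carrier A"
  shows "wf_trm ar t \<Longrightarrow> h (trm_val A \<rho> t) = trm_val B (h \<circ> \<rho>) t"
proof (induction t)
  case (App g ts)
  have "set (map (trm_val A \<rho>) ts) \<subseteq> carrier A"
    using App.prems trm_val_carrier[OF assms(1) _ assms(3)] by (auto simp: list_all_iff)
  then have "h (trm_val A \<rho> (App g ts)) = oper B g (map h (map (trm_val A \<rho>) ts))"
    using App.prems homsD(2)[OF assms(2)] by simp
  also have "map h (map (trm_val A \<rho>) ts) = map (trm_val B (h \<circ> \<rho>)) ts"
    using App by (auto simp: list_all_iff comp_def)
  finally show ?case
    by (simp add: comp_def)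
qed simp

lemma trm_val_Con:
  assumes "\<theta> \<in> Con ar M" "\<And>v. (\<rho> v, \<rho>' v) \<in> \<theta>"
  shows "wf_trm ar t \<Longrightarrow> (trm_val M \<rho> t, trm_val M \<rho>' t) \<in> \<theta>"
  by (induction t)
    (auto simp: assms(2) list_all_iff list_all2_conv_all_nth intro!: Con_oper[OF assms(1)])

lemma variety_alg: "is_variety ar V \<Longrightarrow> M \<in> V \<Longrightarrow> is_alg ar M"
  by (auto simp: is_variety_def)

text \<open>Every valuation in the quotient lifts pointwise to a valuation in \<open>M\<close>; the
  identity holds there, and the quotient map carries it back.\<close>

lemma variety_quot:
  fixes ar :: "'f \<Rightarrow> nat" and M :: "('f, 'a) alg"
  assumes V: "is_variety ar V" and "M \<in> V" and \<theta>: "\<theta> \<in> Con ar M"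
  shows "quot M \<theta> \<in> V"
proof -
  obtain E :: "(('f, nat) trm \<times> ('f, nat) trm) set" where
    wf: "\<forall>(s, t)\<in>E. wf_trm ar s \<and> wf_trm ar t" and
    V: "V = {M. is_alg ar M \<and>
        (\<forall>(s, t)\<in>E. \<forall>\<rho>. range \<rho> \<subseteq> carrier M \<longrightarrow> trm_val M \<rho> s = trm_val M \<rho> t)}"
    using V by (auto simp: is_variety_def)
  have M: "is_alg ar M"
    using \<open>M \<in> V\<close> V by simp
  have "trm_val (quot M \<theta>) \<rho> s = trm_val (quot M \<theta>) \<rho> t"
    if st: "(s, t) \<in> E" and \<rho>: "range \<rho> \<subseteq> carrier (quot M \<theta>)" for s t and \<rho> :: "nat \<Rightarrow> 'a"
  proof -
    have "\<forall>v. \<exists>x. x \<in> carrier M \<and> \<rho> v = rep \<theta> x"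
      using \<rho> by (auto simp: carrier_quot)
    then obtain \<sigma> where \<sigma>: "\<And>v. \<sigma> v \<in> carrier M \<and> \<rho> v = rep \<theta> (\<sigma> v)"
      by metis
    have \<rho>: "\<rho> = rep \<theta> \<circ> \<sigma>" and r: "range \<sigma> \<subseteq> carrier M"
      using \<sigma> by (auto simp: fun_eq_iff)
    have "trm_val M \<sigma> s = trm_val M \<sigma> t"
      using \<open>M \<in> V\<close> V st r by blast
    then show ?thesis
      using trm_val_hom[OF M rep_hom[OF M \<theta>] r] wf st unfolding \<rho> by (metis case_prodD)
  qed
  then show ?thesis
    using quot_alg[OF M \<theta>] by (auto simp: V)
qed


section \<open>Meet irreducible and maximal congruences\<close>

text \<open>Complete meet irreducibility, in the form that \<open>subdirectly_irreducible\<close>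
  takes when pulled back along a quotient map. The empty family has intersection
  \<open>Nabla M\<close>, so \<open>Nabla M\<close> itself is excluded.\<close>

definition meet_irred :: "('f \<Rightarrow> nat) \<Rightarrow> ('f, 'a) alg \<Rightarrow> ('a \<times> 'a) set \<Rightarrow> bool" where
  "meet_irred ar M \<kappa> \<longleftrightarrow>
     \<kappa> \<in> Con ar M \<and> (\<forall>\<Theta> \<subseteq> Con ar M. Nabla M \<inter> \<Inter>\<Theta> = \<kappa> \<longrightarrow> \<kappa> \<in> \<Theta>)"

definition maximal_con :: "('f \<Rightarrow> nat) \<Rightarrow> ('f, 'a) alg \<Rightarrow> ('a \<times> 'a) set \<Rightarrow> bool" where
  "maximal_con ar M \<phi> \<longleftrightarrow> \<phi> \<in> Con ar M \<and> \<phi> \<noteq> Nabla M \<and>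
     (\<forall>\<psi>\<in>Con ar M. \<phi> \<subseteq> \<psi> \<longrightarrow> \<psi> = \<phi> \<or> \<psi> = Nabla M)"

text \<open>Every member of \<open>\<Theta>\<close> other than \<open>\<phi>\<close> lies properly
  above \<open>\<phi>\<close>, hence is \<open>Nabla M\<close>; a family of such members cannot
  intersect to \<open>\<phi>\<close>.\<close>

lemma maximal_con_meet_irred:
  assumes "maximal_con ar M \<phi>"
  shows "meet_irred ar M \<phi>"
  unfolding meet_irred_def
proof (intro conjI allI impI)
  fix \<Theta> assume \<Theta>: "\<Theta> \<subseteq> Con ar M" "Nabla M \<inter> \<Inter>\<Theta> = \<phi>"
  show "\<phi> \<in> \<Theta>"
  proof (rule ccontr)
    assume "\<phi> \<notin> \<Theta>"
    have "\<theta> = Nabla M" if "\<theta> \<in> \<Theta>" for \<theta>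
    proof -
      have "\<theta> \<in> Con ar M" "\<phi> \<subseteq> \<theta>" "\<theta> \<noteq> \<phi>"
        using \<Theta> that \<open>\<phi> \<notin> \<Theta>\<close> by auto
      then show ?thesis
        using assms unfolding maximal_con_def by metis
    qed
    then have "Nabla M \<inter> \<Inter>\<Theta> = Nabla M"
      by auto
    then show False
      using assms \<Theta> by (simp add: maximal_con_def)
  qed
qed (use assms in \<open>simp add: maximal_con_def\<close>)

text \<open>Pulling back along \<open>rep \<kappa>\<close> turns a family of congruences of the
  quotient that intersects to equality into a family on \<open>M\<close> that intersects to
  \<open>\<kappa>\<close>.\<close>

lemma subdirectly_irreducible_quot:
  assumes M: "is_alg ar M" and "meet_irred ar M \<kappa>"
  shows "subdirectly_irreducible ar (quot M \<kappa>)"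
  unfolding subdirectly_irreducible_def
proof (intro allI impI)
  let ?Q = "quot M \<kappa>" and ?p = "\<lambda>\<theta>. pullback M (rep \<kappa>) \<theta>"
  fix \<Theta> assume \<Theta>: "\<Theta> \<subseteq> Con ar ?Q" "Nabla ?Q \<inter> \<Inter>\<Theta> = Delta ?Q"
  have \<kappa>: "\<kappa> \<in> Con ar M"
    using assms(2) by (simp add: meet_irred_def)
  have "?p ` \<Theta> \<subseteq> Con ar M"
    using \<Theta>(1) pullback_Con[OF M rep_hom[OF M \<kappa>]] by blast
  moreover have "Nabla M \<inter> \<Inter>(?p ` \<Theta>) = \<kappa>"
  proof -
    have "(x, y) \<in> Nabla M \<inter> \<Inter>(?p ` \<Theta>) \<longleftrightarrow> (x, y) \<in> \<kappa>" for x y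
    proof (cases "x \<in> carrier M \<and> y \<in> carrier M")
      case True
      then have "(x, y) \<in> Nabla M \<inter> \<Inter>(?p ` \<Theta>) \<longleftrightarrow> (rep \<kappa> x, rep \<kappa> y) \<in> Nabla ?Q \<inter> \<Inter>\<Theta>"
        by (simp add: pullback_def carrier_quot)
      also have "\<dots> \<longleftrightarrow> rep \<kappa> x = rep \<kappa> y"
        using True unfolding \<Theta>(2) by (auto simp: carrier_quot Id_on_iff)
      also have "\<dots> \<longleftrightarrow> (x, y) \<in> \<kappa>"
        using True by (simp add: rep_eq_iff[OF M \<kappa>])
      finally show ?thesis .
    qed (use Con_subset[OF \<kappa>] in auto)
    then show ?thesis
      by (simp add: set_eq_iff split_paired_all)
  qed
  ultimately have "\<kappa> \<in> ?p ` \<Theta>"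
    using assms(2) unfolding meet_irred_def by metis
  then obtain \<theta> where \<theta>: "\<theta> \<in> \<Theta>" "\<kappa> = ?p \<theta>"
    by blast
  have "\<theta> \<subseteq> Nabla ?Q"
    using \<theta>(1) \<Theta>(1) Con_subset by blast
  have "u = v" if "(u, v) \<in> \<theta>" for u v
  proof -
    obtain x y where "x \<in> carrier M" "y \<in> carrier M" "u = rep \<kappa> x" "v = rep \<kappa> y"
      using \<open>(u, v) \<in> \<theta>\<close> \<open>\<theta> \<subseteq> Nabla ?Q\<close> by (auto simp: carrier_quot)
    moreover from this have "(x, y) \<in> ?p \<theta>"
      using that by (simp add: pullback_def)
    ultimately show ?thesis
      using rep_eq_iff[OF M \<kappa>] \<theta>(2) by simp
  qed
  moreover have "Delta ?Q \<subseteq> \<theta>"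
    using \<Theta>(2) \<theta>(1) by blast
  ultimately have "\<theta> = Delta ?Q"
    using \<open>\<theta> \<subseteq> Nabla ?Q\<close> by fast
  then show "Delta ?Q \<in> \<Theta>"
    using \<theta>(1) by simp
qed

text \<open>Operations are finitary, so each closure condition involves finitely many pairs, and
  these already lie in a single member of the chain.\<close>

lemma Union_chain_Con:
  assumes C: "\<C> \<noteq> {}" "\<C> \<subseteq> Con ar M" and ch: "subset.chain \<A> \<C>"
  shows "\<Union>\<C> \<in> Con ar M"
proof -
  have fin: "\<exists>\<theta>\<in>\<C>. X \<subseteq> \<theta>" if "finite X" "X \<subseteq> \<Union>\<C>" for X
    using finite_subset_Union_chain[OF that C(1) ch] by metis
  show ?thesis
  proof (rule ConI)
    show "\<Union>\<C> \<subseteq> Nabla M"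
      using C(2) Con_subset by blast
    show "(x, x) \<in> \<Union>\<C>" if "x \<in> carrier M" for x
    proof -
      obtain \<theta> where "\<theta> \<in> \<C>"
        using C(1) by blast
      then show ?thesis
        using Con_refl[of \<theta> ar M x] C(2) that by blast
    qed
    show "(y, x) \<in> \<Union>\<C>" if "(x, y) \<in> \<Union>\<C>" for x y
    proof -
      obtain \<theta> where "\<theta> \<in> \<C>" "(x, y) \<in> \<theta>"
        using \<open>(x, y) \<in> \<Union>\<C>\<close> by blast
      then show ?thesis
        using Con_sym[of \<theta> ar M x y] C(2) by blast
    qed
    show "(x, z) \<in> \<Union>\<C>" if "(x, y) \<in> \<Union>\<C>" "(y, z) \<in> \<Union>\<C>" for x y z
    proof -
      obtain \<theta> where "\<theta> \<in> \<C>" "{(x, y), (y, z)} \<subseteq> \<theta>"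
        using fin[of "{(x, y), (y, z)}"] \<open>(x, y) \<in> \<Union>\<C>\<close> \<open>(y, z) \<in> \<Union>\<C>\<close> by auto
      then show ?thesis
        using Con_trans[of \<theta> ar M x y z] C(2) by blast
    qed
    fix g xs ys
    assume l: "length xs = ar g" "length ys = ar g"
      and r: "list_all2 (\<lambda>x y. (x, y) \<in> \<Union>\<C>) xs ys"
    then obtain \<theta> where "\<theta> \<in> \<C>" "set (zip xs ys) \<subseteq> \<theta>"
      using fin[of "set (zip xs ys)"] by (auto simp: list_all2_iff)
    then have "list_all2 (\<lambda>x y. (x, y) \<in> \<theta>) xs ys"
      using l by (auto simp: list_all2_iff)
    then show "(oper M g xs, oper M g ys) \<in> \<Union>\<C>"
      using Con_oper[of \<theta> ar M xs g ys] l \<open>\<theta> \<in> \<C>\<close> C(2) by blast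
  qed
qed

text \<open>Zorn's lemma yields a congruence \<open>\<kappa>\<close> above \<open>\<alpha>\<close>
  that is maximal among those omitting \<open>p\<close>. All congruences properly above
  \<open>\<kappa>\<close> contain \<open>p\<close>, and so does their intersection, which therefore
  differs from \<open>\<kappa>\<close>.\<close>

lemma meet_irred_separating:
  assumes \<alpha>: "\<alpha> \<in> Con ar M" and p: "p \<in> Nabla M - \<alpha>"
  obtains \<kappa> where "meet_irred ar M \<kappa>" "\<alpha> \<subseteq> \<kappa>" "p \<notin> \<kappa>"
proof -
  let ?S = "{\<kappa> \<in> Con ar M. \<alpha> \<subseteq> \<kappa> \<and> p \<notin> \<kappa>}"
  have "\<exists>\<kappa>\<in>?S. \<forall>\<theta>\<in>?S. \<kappa> \<subseteq> \<theta> \<longrightarrow> \<theta> = \<kappa>"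
  proof (rule subset_Zorn_nonempty)
    show "?S \<noteq> {}"
      using \<alpha> p by auto
    fix \<C> assume \<C>: "\<C> \<noteq> {}" "subset.chain ?S \<C>"
    then have sub: "\<C> \<subseteq> ?S"
      by (simp add: subset_chain_def)
    then have "\<Union>\<C> \<in> Con ar M"
      using Union_chain_Con[OF \<C>(1) _ \<C>(2)] by blast
    then show "\<Union>\<C> \<in> ?S"
      using sub \<C>(1) by blast
  qed
  then obtain \<kappa> where \<kappa>: "\<kappa> \<in> ?S" and max: "\<And>\<theta>. \<theta> \<in> ?S \<Longrightarrow> \<kappa> \<subseteq> \<theta> \<Longrightarrow> \<theta> = \<kappa>"
    by (elim bexE) simp
  have "\<kappa> \<in> \<Theta>" if "\<Theta> \<subseteq> Con ar M" "Nabla M \<inter> \<Inter>\<Theta> = \<kappa>" for \<Theta>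
  proof (rule ccontr)
    assume n: "\<kappa> \<notin> \<Theta>"
    have "p \<in> \<theta>" if "\<theta> \<in> \<Theta>" for \<theta>
    proof -
      have "\<theta> \<in> Con ar M" "\<kappa> \<subseteq> \<theta>" "\<theta> \<noteq> \<kappa>"
        using \<open>\<theta> \<in> \<Theta>\<close> \<open>\<Theta> \<subseteq> Con ar M\<close> \<open>Nabla M \<inter> \<Inter>\<Theta> = \<kappa>\<close> n by auto
      then show ?thesis
        using max[of \<theta>] \<kappa> by auto
    qed
    then have "p \<in> \<kappa>"
      using that(2) p by blast
    then show False
      using \<kappa> by simp
  qed
  then show ?thesis
    using that[of \<kappa>] \<kappa> by (simp add: meet_irred_def)
qed

text \<open>Separating congruences are naturally indexed by pairs of elements, whereas
  \<open>filtral\<close> takes index sets inside \<open>'u\<close>; this injection moves the indices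
  there.\<close>

lemma inj_pair_infinite: "\<exists>p :: 'u::infinite \<times> 'u \<Rightarrow> 'u. inj p"
  by (metis UNIV_Times_UNIV card_of_Times_same_infinite card_of_ordLeq infinite_UNIV
      ordIso_imp_ordLeq)

text \<open>A form of Birkhoff's subdirect representation theorem in which every factor lies above
  one of two given congruences.\<close>

lemma meet_irred_family:
  fixes M :: "('f, 'u :: infinite) alg"
  assumes \<alpha>: "\<alpha> \<in> Con ar M" and \<beta>: "\<beta> \<in> Con ar M"
  obtains I :: "'u set" and \<kappa> where "\<And>i. i \<in> I \<Longrightarrow> meet_irred ar M (\<kappa> i)"
    "\<And>i. i \<in> I \<Longrightarrow> \<alpha> \<subseteq> \<kappa> i \<or> \<beta> \<subseteq> \<kappa> i" "Nabla M \<inter> (\<Inter>i\<in>I. \<kappa> i) \<subseteq> \<alpha> \<inter> \<beta>"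
proof -
  obtain p :: "'u \<times> 'u \<Rightarrow> 'u" where p: "inj p"
    using inj_pair_infinite by blast
  have "\<exists>\<kappa>. meet_irred ar M \<kappa> \<and> (\<alpha> \<subseteq> \<kappa> \<or> \<beta> \<subseteq> \<kappa>) \<and> q \<notin> \<kappa>"
    if "q \<in> Nabla M - \<alpha> \<inter> \<beta>" for q
  proof (cases "q \<in> \<alpha>")
    case True
    then have "q \<in> Nabla M - \<beta>"
      using that by auto
    then show ?thesis
      using meet_irred_separating[OF \<beta>] by metis
  next
    case False
    then have "q \<in> Nabla M - \<alpha>"
      using that by auto
    then show ?thesis
      using meet_irred_separating[OF \<alpha>] by metis
  qed
  then obtain k where k: "\<And>q. q \<in> Nabla M - \<alpha> \<inter> \<beta> \<Longrightarrow>
      meet_irred ar M (k q) \<and> (\<alpha> \<subseteq> k q \<or> \<beta> \<subseteq> k q) \<and> q \<notin> k q"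
    by metis
  show ?thesis
  proof (rule that[of "p ` (Nabla M - \<alpha> \<inter> \<beta>)" "k \<circ> inv p"])
    show "Nabla M \<inter> (\<Inter>i\<in>p ` (Nabla M - \<alpha> \<inter> \<beta>). (k \<circ> inv p) i) \<subseteq> \<alpha> \<inter> \<beta>"
    proof
      fix q assume "q \<in> Nabla M \<inter> (\<Inter>i\<in>p ` (Nabla M - \<alpha> \<inter> \<beta>). (k \<circ> inv p) i)"
      then have "q \<in> Nabla M" "q \<in> Nabla M - \<alpha> \<inter> \<beta> \<Longrightarrow> q \<in> k q"
        using inv_f_f[OF p] by auto
      then show "q \<in> \<alpha> \<inter> \<beta>"
        using k by blast
    qed
  next
    fix i assume "i \<in> p ` (Nabla M - \<alpha> \<inter> \<beta>)"
    then obtain q where "i = p q" "q \<in> Nabla M - \<alpha> \<inter> \<beta>"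
      by blast
    then show "meet_irred ar M ((k \<circ> inv p) i)" "\<alpha> \<subseteq> (k \<circ> inv p) i \<or> \<beta> \<subseteq> (k \<circ> inv p) i"
      using k[of q] inv_f_f[OF p] by auto
  qed
qed

section \<open>Subdirect products in filtral varieties\<close>

text \<open>The family is given by maps \<open>h i\<close> out of \<open>A\<close> instead of a
  subset of a product, so \<open>A\<close> may have a type of its own and the maps need not separate
  its points. The improper filter gives \<open>Nabla A\<close>.\<close>

definition filter_con ::
  "('f, 'a) alg \<Rightarrow> ('i \<Rightarrow> 'a \<Rightarrow> 'b) \<Rightarrow> 'i filter \<Rightarrow> ('a \<times> 'a) set" where
  "filter_con A h W = {(a, b) \<in> Nabla A. eventually (\<lambda>i. h i a = h i b) W}"

lemma filter_con_iff:
  "(a, b) \<in> filter_con A h W \<longleftrightarrow>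
     a \<in> carrier A \<and> b \<in> carrier A \<and> eventually (\<lambda>i. h i a = h i b) W"
  by (auto simp: filter_con_def)

lemma eventually_in_index: "W \<le> principal I \<Longrightarrow> eventually (\<lambda>i. i \<in> I) W"
  by (simp add: le_principal)

text \<open>An operation has finitely many arguments, and finitely many sets of agreement still
  intersect in a set of the filter.\<close>

lemma filter_con_Con:
  assumes A: "is_alg ar A" and h: "\<And>i. i \<in> I \<Longrightarrow> h i \<in> homs ar A (M i)" and W: "W \<le> principal I"
  shows "filter_con A h W \<in> Con ar A"
proof (rule ConI)
  fix g xs ys
  assume l: "length xs = ar g" "length ys = ar g"
    and r: "list_all2 (\<lambda>x y. (x, y) \<in> filter_con A h W) xs ys"
  have s: "set xs \<subseteq> carrier A" "set ys \<subseteq> carrier A"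
    using list_all2_subset[OF r, of "carrier A"] by (auto simp: filter_con_def)
  have "\<forall>(x, y)\<in>set (zip xs ys). eventually (\<lambda>i. h i x = h i y) W"
    using r by (auto simp: list_all2_iff filter_con_iff)
  then have "eventually (\<lambda>i. \<forall>p\<in>set (zip xs ys). h i (fst p) = h i (snd p)) W"
    by (intro eventually_ball_finite) auto
  with eventually_in_index[OF W]
  have "eventually (\<lambda>i. h i (oper A g xs) = h i (oper A g ys)) W"
  proof eventually_elim
    case (elim i)
    then have "map (h i) xs = map (h i) ys"
      using l by (auto simp: list_eq_iff_nth_eq set_zip)
    then show ?case
      using homsD(2)[OF h[OF elim(1)]] l s by simp
  qed
  then show "(oper A g xs, oper A g ys) \<in> filter_con A h W"
    using is_algD(2)[OF A] l s by (simp add: filter_con_iff)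
next
  show "(x, z) \<in> filter_con A h W"
    if "(x, y) \<in> filter_con A h W" "(y, z) \<in> filter_con A h W" for x y z
    using that unfolding filter_con_iff by (auto elim: eventually_elim2)
qed (auto simp: filter_con_def eq_commute)

text \<open>Factors and indices live in \<open>'u\<close>, as \<open>filtral\<close> demands, while
  \<open>A\<close> has its own type. Surjectivity of the maps \<open>h i\<close> is left to the
  individual lemmas, because preimages under arbitrary morphisms lead to families whose maps are not
  onto.\<close>

locale filtral_family =
  fixes ar :: "'f \<Rightarrow> nat" and V :: "('f, 'u) alg set" and A :: "('f, 'a) alg"
    and I :: "'u set" and M :: "'u \<Rightarrow> ('f, 'u) alg" and h :: "'u \<Rightarrow> 'a \<Rightarrow> 'u"
  assumes filtral: "filtral ar V" and A: "is_alg ar A"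
    and MV: "\<And>i. i \<in> I \<Longrightarrow> M i \<in> V" and M: "\<And>i. i \<in> I \<Longrightarrow> is_alg ar (M i)"
    and si: "\<And>i. i \<in> I \<Longrightarrow> subdirectly_irreducible ar (M i)"
    and h: "\<And>i. i \<in> I \<Longrightarrow> h i \<in> homs ar A (M i)"
begin

text \<open>Filtrality is applied to the algebra of all \<open>x\<close> in the product that agree \<open>W\<close>-almost
  everywhere with the image \<open>(h i a)\<^sub>i\<close> of some \<open>a\<close>, the limit of \<open>x\<close>. It is large enough for
  gluing elements along subsets of \<open>I\<close>, and a congruence of \<open>A\<close> extends to it through limits.\<close>

lemma filter_of_con:
  assumes W: "W \<le> principal I"
    and onto: "\<And>i m. i \<in> I \<Longrightarrow> m \<in> carrier (M i) \<Longrightarrow> m \<in> h i ` carrier A \<or> eventually (\<lambda>j. j \<noteq> i) W"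
    and \<psi>: "\<psi> \<in> Con ar A" and W\<psi>: "filter_con A h W \<subseteq> \<psi>"
  obtains G where "G \<le> principal I"
    "\<And>a b x y. a \<in> carrier A \<Longrightarrow> b \<in> carrier A \<Longrightarrow>
       x \<in> (\<Pi>\<^sub>E i\<in>I. carrier (M i)) \<Longrightarrow> y \<in> (\<Pi>\<^sub>E i\<in>I. carrier (M i)) \<Longrightarrow>
       eventually (\<lambda>i. x i = h i a) W \<Longrightarrow> eventually (\<lambda>i. y i = h i b) W \<Longrightarrow>
       (a, b) \<in> \<psi> \<longleftrightarrow> eventually (\<lambda>i. x i = y i) G"
proof -
  let ?P = "\<Pi>\<^sub>E i\<in>I. carrier (M i)"
  define T where "T = {x \<in> ?P. \<exists>a\<in>carrier A. eventually (\<lambda>i. x i = h i a) W}"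
  let ?Q = "(product_alg I M)\<lparr>carrier := T\<rparr>"
  have "\<forall>x\<in>T. \<exists>a. a \<in> carrier A \<and> eventually (\<lambda>i. x i = h i a) W"
    by (auto simp: T_def)
  then obtain lim where lim: "\<And>x. x \<in> T \<Longrightarrow> lim x \<in> carrier A"
    "\<And>x. x \<in> T \<Longrightarrow> eventually (\<lambda>i. x i = h i (lim x)) W"
    by metis
  have ev: "eventually (\<lambda>i. oper ?Q g xs i = h i (oper A g (map lim xs))) W"
    if xs: "length xs = ar g" "set xs \<subseteq> T" for g xs
  proof -
    have "eventually (\<lambda>i. \<forall>x\<in>set xs. x i = h i (lim x)) W"
      using lim(2) xs(2) by (intro eventually_ball_finite) auto
    with eventually_in_index[OF W] show ?thesis
    proof eventually_elim
      case (elim i)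
      have "h i (oper A g (map lim xs)) = oper (M i) g (map (h i) (map lim xs))"
        using xs lim(1) by (intro homsD(2)[OF h[OF elim(1)]]) auto
      also have "map (h i) (map lim xs) = map (\<lambda>x. x i) xs"
        using elim(2) by simp
      finally show ?case
        using elim(1) by (simp add: product_alg_def)
    qed
  qed
  have oper_T: "oper ?Q g xs \<in> T" if xs: "length xs = ar g" "set xs \<subseteq> T" for g xs
  proof -
    have "oper (M i) g (map (\<lambda>x. x i) xs) \<in> carrier (M i)" if "i \<in> I" for i
      using xs that by (intro is_algD(2)[OF M]) (auto simp: T_def)
    then have "oper ?Q g xs \<in> ?P"
      by (auto simp: product_alg_def)
    moreover have "oper A g (map lim xs) \<in> carrier A"
      using xs lim(1) by (intro is_algD(2)[OF A]) auto
    ultimately show ?thesis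
      using ev[OF xs] unfolding T_def by blast
  qed
  have diag: "(\<lambda>i\<in>I. h i a) \<in> T" if "a \<in> carrier A" for a
  proof -
    have "eventually (\<lambda>i. (\<lambda>i\<in>I. h i a) i = h i a) W"
      using eventually_in_index[OF W] by eventually_elim simp
    moreover have "(\<lambda>i\<in>I. h i a) \<in> ?P"
      using that homsD(1)[OF h] by auto
    ultimately show ?thesis
      using that unfolding T_def by blast
  qed
  \<comment> \<open>Either the image of \<open>A\<close> already reaches \<open>m\<close>, or
    \<open>W\<close> does not notice coordinate \<open>i\<close> and the image of any element may be
    changed to \<open>m\<close> there.\<close>
  have "m \<in> (\<lambda>x. x i) ` T" if i: "i \<in> I" and m: "m \<in> carrier (M i)" for i m
    using onto[OF i m]
  proof
    assume "m \<in> h i ` carrier A"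
    then obtain a where "a \<in> carrier A" "m = h i a"
      by blast
    then show ?thesis
      using diag[of a] i by (force intro!: image_eqI[of _ _ "\<lambda>i\<in>I. h i a"])
  next
    assume ne: "eventually (\<lambda>j. j \<noteq> i) W"
    obtain a where a: "a \<in> carrier A"
      using is_algD(1)[OF A] by blast
    let ?x = "(\<lambda>i\<in>I. h i a)(i := m)"
    have "eventually (\<lambda>j. ?x j = h j a) W"
      using eventually_in_index[OF W] ne by eventually_elim simp
    moreover have "?x \<in> ?P"
      using i m homsD(1)[OF h a] by (auto simp: PiE_iff extensional_def)
    ultimately have "?x \<in> T"
      using a unfolding T_def by blast
    then show ?thesis
      by (force intro!: image_eqI[of _ _ ?x])
  qed
  then have "(\<lambda>x. x i) ` T = carrier (M i)" if "i \<in> I" for i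
    using that by (auto simp: T_def)
  moreover have "subuniverse ar (product_alg I M) T"
    unfolding subuniverse_def
  proof (intro conjI allI impI)
    show "T \<noteq> {}"
      using diag is_algD(1)[OF A] by blast
    show "T \<subseteq> carrier (product_alg I M)"
      by (auto simp: T_def product_alg_def)
  qed (use oper_T in simp)
  ultimately have "subdirect_product ar I M T"
    by (simp add: subdirect_product_def)
  define \<theta> where "\<theta> = {(x, y) \<in> T \<times> T. (lim x, lim y) \<in> \<psi>}"
  \<comment> \<open>The chosen limits are determined only up to agreement \<open>W\<close>-almost
    everywhere; by \<open>filter_con A h W \<subseteq> \<psi>\<close> they are unique modulo
    \<open>\<psi>\<close>.\<close>
  have lim_\<psi>: "(lim x, a) \<in> \<psi>"
    if "x \<in> T" "a \<in> carrier A" "eventually (\<lambda>i. x i = h i a) W" for x a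
  proof -
    have "eventually (\<lambda>i. h i (lim x) = h i a) W"
      using lim(2)[OF that(1)] that(3) by eventually_elim simp
    then show ?thesis
      using lim(1) that W\<psi> by (auto simp: filter_con_iff)
  qed
  have "\<theta> \<in> Con ar ?Q"
  proof (rule ConI)
    fix g xs ys
    assume l: "length xs = ar g" "length ys = ar g" and r: "list_all2 (\<lambda>x y. (x, y) \<in> \<theta>) xs ys"
    have s: "set xs \<subseteq> T" "set ys \<subseteq> T"
      using list_all2_subset[OF r, of T] by (auto simp: \<theta>_def)
    have "list_all2 (\<lambda>a b. (a, b) \<in> \<psi>) (map lim xs) (map lim ys)"
      using r by (auto simp: list_all2_conv_all_nth \<theta>_def)
    then have "(oper A g (map lim xs), oper A g (map lim ys)) \<in> \<psi>"
      using Con_oper[OF \<psi>] l by simp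
    moreover have "(lim (oper ?Q g zs), oper A g (map lim zs)) \<in> \<psi>"
      if "length zs = ar g" "set zs \<subseteq> T" for zs
      using that lim(1) by (intro lim_\<psi> oper_T ev is_algD(2)[OF A]) auto
    ultimately have "(lim (oper ?Q g xs), lim (oper ?Q g ys)) \<in> \<psi>"
      using l s by (meson Con_sym[OF \<psi>] Con_trans[OF \<psi>])
    then show "(oper ?Q g xs, oper ?Q g ys) \<in> \<theta>"
      using oper_T l s by (simp add: \<theta>_def)
  next
    show "(x, z) \<in> \<theta>" if "(x, y) \<in> \<theta>" "(y, z) \<in> \<theta>" for x y z
      using that Con_trans[OF \<psi>, of "lim x" "lim y" "lim z"] by (simp add: \<theta>_def)
  qed (auto simp: \<theta>_def lim(1) intro: Con_refl[OF \<psi>] Con_sym[OF \<psi>])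
  then obtain G where G: "G \<le> principal I"
    "\<theta> = {(x, y) \<in> T \<times> T. eventually (\<lambda>i. i \<in> I \<and> x i = y i) G}"
    using filtral \<open>subdirect_product ar I M T\<close> MV si unfolding filtral_def by meson
  show ?thesis
  proof (rule that[OF G(1)])
    fix a b x y
    assume a: "a \<in> carrier A" "b \<in> carrier A" and "x \<in> ?P" "y \<in> ?P"
      and x: "eventually (\<lambda>i. x i = h i a) W" "eventually (\<lambda>i. y i = h i b) W"
    then have T: "x \<in> T" "y \<in> T"
      by (auto simp: T_def)
    have "(lim x, a) \<in> \<psi>" "(lim y, b) \<in> \<psi>"
      using lim_\<psi> T a x by blast+
    then have "(a, b) \<in> \<psi> \<longleftrightarrow> (lim x, lim y) \<in> \<psi>"
      by (meson Con_sym[OF \<psi>] Con_trans[OF \<psi>])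
    also have "\<dots> \<longleftrightarrow> (x, y) \<in> \<theta>"
      using T by (simp add: \<theta>_def)
    also have "\<dots> \<longleftrightarrow> eventually (\<lambda>i. x i = y i) G"
      using T eventually_in_index[OF G(1)] by (simp add: G(2) eventually_conj_iff)
    finally show "(a, b) \<in> \<psi> \<longleftrightarrow> eventually (\<lambda>i. x i = y i) G" .
  qed
qed

text \<open>A pair \<open>a, b\<close> of a properly larger congruence \<open>\<psi>\<close> must
  differ \<open>W\<close>-almost everywhere, by \<open>decides\<close>, yet it agrees
  \<open>G\<close>-almost everywhere for the filter \<open>G\<close> that describes
  \<open>\<psi>\<close>. Any \<open>x\<close> and \<open>y\<close> can then be glued along the set
  where \<open>a\<close> and \<open>b\<close> agree: \<open>W\<close> sees only \<open>y\<close>,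
  \<open>G\<close> sees only \<open>x\<close>, and \<open>\<psi>\<close> identifies the two.\<close>

lemma maximal_filter_con:
  assumes W: "W \<le> principal I"
    and onto: "\<And>i m. i \<in> I \<Longrightarrow> m \<in> carrier (M i) \<Longrightarrow> m \<in> h i ` carrier A \<or> eventually (\<lambda>j. j \<noteq> i) W"
    and decides: "\<And>a b. a \<in> carrier A \<Longrightarrow> b \<in> carrier A \<Longrightarrow>
      eventually (\<lambda>i. h i a = h i b) W \<or> eventually (\<lambda>i. h i a \<noteq> h i b) W"
    and proper: "filter_con A h W \<noteq> Nabla A"
  shows "maximal_con ar A (filter_con A h W)"
proof -
  have "\<psi> = Nabla A"
    if \<psi>: "\<psi> \<in> Con ar A" and sub: "filter_con A h W \<subseteq> \<psi>" and "\<psi> \<noteq> filter_con A h W" for \<psi>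
  proof -
    obtain a b where ab: "(a, b) \<in> \<psi>" "(a, b) \<notin> filter_con A h W"
      using sub \<open>\<psi> \<noteq> filter_con A h W\<close> by auto
    then have carr: "a \<in> carrier A" "b \<in> carrier A"
      using Con_subset[OF \<psi>] by auto
    then have ne: "eventually (\<lambda>i. h i a \<noteq> h i b) W"
      using ab(2) decides by (auto simp: filter_con_iff)
    obtain G where G: "G \<le> principal I"
      and iff: "\<And>a b x y. a \<in> carrier A \<Longrightarrow> b \<in> carrier A \<Longrightarrow>
       x \<in> (\<Pi>\<^sub>E i\<in>I. carrier (M i)) \<Longrightarrow> y \<in> (\<Pi>\<^sub>E i\<in>I. carrier (M i)) \<Longrightarrow>
       eventually (\<lambda>i. x i = h i a) W \<Longrightarrow> eventually (\<lambda>i. y i = h i b) W \<Longrightarrow>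
       (a, b) \<in> \<psi> \<longleftrightarrow> eventually (\<lambda>i. x i = y i) G"
      using filter_of_con[OF W onto \<psi> sub] by blast
    let ?d = "\<lambda>a. \<lambda>i\<in>I. h i a"
    have d: "?d c \<in> (\<Pi>\<^sub>E i\<in>I. carrier (M i))" "eventually (\<lambda>i. ?d c i = h i c) W"
      if "c \<in> carrier A" for c
    proof -
      show "?d c \<in> (\<Pi>\<^sub>E i\<in>I. carrier (M i))"
        using that homsD(1)[OF h] by auto
      show "eventually (\<lambda>i. ?d c i = h i c) W"
        using eventually_in_index[OF W] by eventually_elim simp
    qed
    have "eventually (\<lambda>i. ?d a i = ?d b i) G"
      using iff[OF carr d(1) d(1) d(2) d(2)] carr ab(1) by simp
    with eventually_in_index[OF G] have eq: "eventually (\<lambda>i. h i a = h i b) G"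
      by eventually_elim simp
    have "(y, x) \<in> \<psi>" if c: "x \<in> carrier A" "y \<in> carrier A" for x y
    proof -
      \<comment> \<open>an element with limit \<open>y\<close> that coincides with \<open>x\<close> on a set of \<open>G\<close>\<close>
      let ?c = "\<lambda>i\<in>I. if h i a = h i b then h i x else h i y"
      have "?c \<in> (\<Pi>\<^sub>E i\<in>I. carrier (M i))"
        using c homsD(1)[OF h] by auto
      moreover have "eventually (\<lambda>i. ?c i = h i y) W"
        using eventually_in_index[OF W] ne by eventually_elim simp
      moreover have "eventually (\<lambda>i. ?c i = ?d x i) G"
        using eventually_in_index[OF G] eq by eventually_elim simp
      ultimately show ?thesis
        using iff[OF c(2) c(1) _ d(1)[OF c(1)] _ d(2)[OF c(1)]] by blast
    qed
    then show ?thesis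
      using Con_subset[OF \<psi>] by auto
  qed
  then show ?thesis
    using filter_con_Con[OF A h W] proper by (auto simp: maximal_con_def)
qed

text \<open>With \<open>W = principal I\<close>, an element of the enlarged algebra equals the image
  of its limit on all of \<open>I\<close>. So the enlarged algebra is the image of \<open>A\<close>,
  and \<open>filter_of_con\<close> becomes filtrality expressed on \<open>A\<close>.\<close>

lemma con_eq_filter_con:
  assumes onto: "\<And>i. i \<in> I \<Longrightarrow> h i ` carrier A = carrier (M i)"
    and \<psi>: "\<psi> \<in> Con ar A" and sub: "filter_con A h (principal I) \<subseteq> \<psi>"
  obtains G where "G \<le> principal I" "\<psi> = filter_con A h G"
proof -
  obtain G where G: "G \<le> principal I"
    and iff: "\<And>a b x y. a \<in> carrier A \<Longrightarrow> b \<in> carrier A \<Longrightarrow>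
     x \<in> (\<Pi>\<^sub>E i\<in>I. carrier (M i)) \<Longrightarrow> y \<in> (\<Pi>\<^sub>E i\<in>I. carrier (M i)) \<Longrightarrow>
     eventually (\<lambda>i. x i = h i a) (principal I) \<Longrightarrow> eventually (\<lambda>i. y i = h i b) (principal I) \<Longrightarrow>
     (a, b) \<in> \<psi> \<longleftrightarrow> eventually (\<lambda>i. x i = y i) G"
    using filter_of_con[OF order_refl _ \<psi> sub] onto by blast
  have "(a, b) \<in> \<psi> \<longleftrightarrow> eventually (\<lambda>i. h i a = h i b) G"
    if "a \<in> carrier A" "b \<in> carrier A" for a b
  proof -
    have "(a, b) \<in> \<psi> \<longleftrightarrow> eventually (\<lambda>i. (\<lambda>i\<in>I. h i a) i = (\<lambda>i\<in>I. h i b) i) G"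
      using that homsD(1)[OF h] by (intro iff) (auto simp: eventually_principal)
    also have "\<dots> \<longleftrightarrow> eventually (\<lambda>i. h i a = h i b) G"
      by (rule eventually_subst) (use eventually_in_index[OF G] in eventually_elim, simp)
    finally show ?thesis .
  qed
  then have "\<psi> = filter_con A h G"
    using Con_subset[OF \<psi>] by (auto simp: filter_con_iff)
  then show ?thesis
    using that G by blast
qed

text \<open>Among the filters that induce \<open>\<psi>\<close>, choose one with as many sets as
  possible. Restricting it to \<open>P\<close> and to the complement of \<open>P\<close> gives two
  congruences whose intersection is below \<open>\<psi>\<close>. Primality puts one of them below
  \<open>\<psi>\<close>, and by the choice of \<open>G\<close> that restriction is \<open>G\<close>
  itself.\<close>

lemma Spec_eq_ultrafilter_con:
  assumes onto: "\<And>i. i \<in> I \<Longrightarrow> h i ` carrier A = carrier (M i)"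
    and \<psi>: "\<psi> \<in> Spec ar A" and sub: "filter_con A h (principal I) \<subseteq> \<psi>"
  obtains G where "G \<le> principal I" "\<psi> = filter_con A h G"
    "\<And>P. eventually P G \<or> eventually (\<lambda>i. \<not> P i) G"
proof -
  let ?S = "{G. G \<le> principal I \<and> filter_con A h G = \<psi>}"
  have "\<psi> \<in> Con ar A"
    using \<psi> by (simp add: Spec_def)
  then obtain G0 where G0: "G0 \<in> ?S"
    using con_eq_filter_con[OF onto _ sub] by blast
  \<comment> \<open>A smaller filter in the library order has more sets, so the maximal family of
    sets is a minimal element here, and chains are bounded by their infimum.\<close>
  have "\<exists>G\<in>?S. \<forall>F\<in>?S. F \<le> G \<longrightarrow> F = G"
  proof (rule predicate_Zorn)
    show "partial_order_on ?S (relation_of (\<lambda>F G. G \<le> F) ?S)"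
      by (rule partial_order_on_relation_ofI) auto
    fix C assume "C \<in> Chains (relation_of (\<lambda>F G. G \<le> F) ?S)"
    then have C: "C \<subseteq> ?S" and ch: "\<And>F G. F \<in> C \<Longrightarrow> G \<in> C \<Longrightarrow> F \<le> G \<or> G \<le> F"
      unfolding Chains_def relation_of_def by blast+
    show "\<exists>G\<in>?S. \<forall>F\<in>C. G \<le> F"
    proof (cases "C = {}")
      case False
      then obtain F where "F \<in> C"
        by blast
      \<comment> \<open>Along a chain the infimum adds no sets beyond those of its members, so it
        still induces \<open>\<psi>\<close>.\<close>
      have ev: "eventually P (Inf C) \<longleftrightarrow> (\<exists>F\<in>C. eventually P F)" for P
        by (rule eventually_Inf_base[OF False]) (meson ch inf_greatest order_refl)
      have "F \<le> principal I"
        using \<open>F \<in> C\<close> C by auto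
      then have "Inf C \<le> principal I"
        using Inf_lower[OF \<open>F \<in> C\<close>] by (rule order_trans[rotated])
      moreover have "(a, b) \<in> filter_con A h (Inf C) \<longleftrightarrow> (a, b) \<in> \<psi>" for a b
      proof -
        have "(a, b) \<in> filter_con A h (Inf C) \<longleftrightarrow> (\<exists>F\<in>C. (a, b) \<in> filter_con A h F)"
          using False by (auto simp: filter_con_iff ev)
        also have "\<dots> \<longleftrightarrow> (a, b) \<in> \<psi>"
          using \<open>F \<in> C\<close> C by auto
        finally show ?thesis .
      qed
      ultimately have "Inf C \<in> ?S"
        by auto
      then show ?thesis
        using Inf_lower[of _ C] by (intro bexI[of _ "Inf C"]) auto
    qed (use G0 in blast)
  qed
  then obtain G where G: "G \<in> ?S" and min: "\<And>F. F \<in> ?S \<Longrightarrow> F \<le> G \<Longrightarrow> F = G"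
    by (elim bexE) simp
  show ?thesis
  proof (rule that)
    show "G \<le> principal I" "\<psi> = filter_con A h G"
      using G by auto
    fix P
    let ?F = "\<lambda>Q. inf G (principal (Collect Q))"
    have le: "?F Q \<le> principal I" for Q
      using \<open>G \<le> principal I\<close> by (simp add: le_infI1)
    have Con: "filter_con A h (?F Q) \<in> Con ar A" for Q
      using A h le by (rule filter_con_Con)
    have up: "\<psi> \<subseteq> filter_con A h (?F Q)" for Q
      unfolding \<open>\<psi> = filter_con A h G\<close>
      by (auto simp: filter_con_iff eventually_inf_principal elim: eventually_mono)
    have *: "eventually Q G" if "filter_con A h (?F Q) \<subseteq> \<psi>" for Q
    proof -
      have "?F Q = G"
        using min[of "?F Q"] le up that by auto
      then have "G \<le> principal (Collect Q)"
        by (simp add: inf.absorb_iff1)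
      then show ?thesis
        by (simp add: le_principal)
    qed
    have "filter_con A h (?F P) \<inter> filter_con A h (?F (\<lambda>i. \<not> P i)) \<subseteq> filter_con A h G"
      by (auto simp: filter_con_iff eventually_inf_principal elim: eventually_elim2)
    then have "filter_con A h (?F P) \<subseteq> \<psi> \<or> filter_con A h (?F (\<lambda>i. \<not> P i)) \<subseteq> \<psi>"
      using \<psi> Con \<open>\<psi> = filter_con A h G\<close> unfolding Spec_def by auto
    then show "eventually P G \<or> eventually (\<lambda>i. \<not> P i) G"
      using * by blast
  qed
qed

end

section \<open>Semi-degenerate filtral varieties\<close>

context
  fixes ar :: "'f \<Rightarrow> nat" and V :: "('f, 'u :: infinite) alg set"
  assumes V: "is_variety ar V" and filtral: "filtral ar V"
begin

lemma filtral_family_quot: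
  assumes "A \<in> V" and \<kappa>: "\<And>i. i \<in> I \<Longrightarrow> meet_irred ar A (\<kappa> i)"
  shows "filtral_family ar V A I (\<lambda>i. quot A (\<kappa> i)) (\<lambda>i. rep (\<kappa> i))"
proof -
  have A: "is_alg ar A"
    using variety_alg V \<open>A \<in> V\<close> .
  have "\<kappa> i \<in> Con ar A" if "i \<in> I" for i
    using \<kappa>[OF that] by (simp add: meet_irred_def)
  then show ?thesis
    using variety_quot[OF V \<open>A \<in> V\<close>] quot_alg[OF A] rep_hom[OF A]
      subdirectly_irreducible_quot[OF A \<kappa>] filtral A
    by unfold_locales auto
qed

lemma filter_con_rep_principal:
  assumes "A \<in> V" "\<And>i. i \<in> I \<Longrightarrow> meet_irred ar A (\<kappa> i)"
  shows "filter_con A (\<lambda>i. rep (\<kappa> i)) (principal I) = Nabla A \<inter> (\<Inter>i\<in>I. \<kappa> i)"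
proof -
  have A: "is_alg ar A"
    using variety_alg V \<open>A \<in> V\<close> .
  have "\<kappa> i \<in> Con ar A" if "i \<in> I" for i
    using assms(2)[OF that] by (simp add: meet_irred_def)
  then show ?thesis
    using rep_eq_iff[OF A] by (auto simp: filter_con_iff eventually_principal)
qed

text \<open>The case of a single factor: subdirectly irreducible members of a filtral variety are
  simple. The principal filter of a singleton decides every equality, so
  \<open>maximal_filter_con\<close> applies to the quotient map.\<close>

lemma meet_irred_maximal_con:
  assumes "A \<in> V" and \<kappa>: "meet_irred ar A \<kappa>"
  shows "maximal_con ar A \<kappa>"
proof -
  have A: "is_alg ar A"
    using variety_alg V \<open>A \<in> V\<close> .
  have Con: "\<kappa> \<in> Con ar A"
    using \<kappa> by (simp add: meet_irred_def)
  have "\<kappa> \<noteq> Nabla A"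
    using \<kappa> unfolding meet_irred_def by (metis Inf_empty empty_iff empty_subsetI inf_top_right)
  fix i :: 'u
  interpret filtral_family ar V A "{i}" "\<lambda>_. quot A \<kappa>" "\<lambda>_. rep \<kappa>"
    using filtral_family_quot[OF \<open>A \<in> V\<close> \<kappa>] .
  have eq: "filter_con A (\<lambda>_ :: 'u. rep \<kappa>) (principal {i}) = \<kappa>"
    using filter_con_rep_principal[OF \<open>A \<in> V\<close> \<kappa>, of "{i}"] Con_subset[OF Con] by auto
  have "maximal_con ar A (filter_con A (\<lambda>_ :: 'u. rep \<kappa>) (principal {i}))"
    by (intro maximal_filter_con) (auto simp: carrier_quot eventually_principal eq \<open>\<kappa> \<noteq> Nabla A\<close>)
  then show ?thesis
    by (simp only: eq)
qed

lemma Spec_maximal_con: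
  assumes "A \<in> V" and \<psi>: "\<psi> \<in> Spec ar A"
  shows "maximal_con ar A \<psi>"
proof -
  have A: "is_alg ar A"
    using variety_alg V \<open>A \<in> V\<close> .
  have \<psi>': "\<psi> \<in> Con ar A" "\<psi> \<noteq> Nabla A"
    using \<psi> by (auto simp: Spec_def)
  \<comment> \<open>Taking equality for both given congruences yields an ordinary subdirect
    representation of \<open>A\<close>.\<close>
  obtain I :: "'u set" and \<kappa> where \<kappa>: "\<And>i. i \<in> I \<Longrightarrow> meet_irred ar A (\<kappa> i)"
    and "Nabla A \<inter> (\<Inter>i\<in>I. \<kappa> i) \<subseteq> Delta A \<inter> Delta A"
    using meet_irred_family[OF Delta_Con[OF A] Delta_Con[OF A]] by metis
  moreover have "Delta A \<subseteq> \<psi>"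
    using Con_refl[OF \<psi>'(1)] by auto
  moreover have "filter_con A (\<lambda>i. rep (\<kappa> i)) (principal I) = Nabla A \<inter> (\<Inter>i\<in>I. \<kappa> i)"
    using \<open>A \<in> V\<close> \<kappa> by (rule filter_con_rep_principal)
  ultimately have sub: "filter_con A (\<lambda>i. rep (\<kappa> i)) (principal I) \<subseteq> \<psi>"
    by auto
  interpret filtral_family ar V A I "\<lambda>i. quot A (\<kappa> i)" "\<lambda>i. rep (\<kappa> i)"
    using filtral_family_quot[OF \<open>A \<in> V\<close> \<kappa>] .
  obtain G where G: "G \<le> principal I" "\<psi> = filter_con A (\<lambda>i. rep (\<kappa> i)) G"
    "\<And>P. eventually P G \<or> eventually (\<lambda>i. \<not> P i) G"
    using Spec_eq_ultrafilter_con[OF _ \<psi> sub] carrier_quot by metis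
  show ?thesis
    unfolding G(2)
    using maximal_filter_con[OF G(1) _ G(3)] \<psi>'(2) unfolding G(2) carrier_quot by blast
qed

text \<open>Coatoms of a distributive lattice are meet-prime, but here the index set does the work.
  Every factor lies above \<open>\<alpha>\<close> or \<open>\<beta>\<close>. Restricting the filter
  of \<open>\<phi>\<close> to the indices of either kind gives congruences
  \<open>?F \<alpha>\<close> and \<open>?F \<beta>\<close> above \<open>\<phi>\<close>, containing
  \<open>\<alpha>\<close> and \<open>\<beta>\<close> respectively. As the two kinds cover
  \<open>I\<close>, their intersection is below \<open>\<phi>\<close>; so one of them is proper,
  hence equal to \<open>\<phi>\<close>.\<close>

lemma maximal_con_Spec:
  assumes "A \<in> V" and "maximal_con ar A \<phi>"
  shows "\<phi> \<in> Spec ar A"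
proof -
  have A: "is_alg ar A"
    using variety_alg V \<open>A \<in> V\<close> .
  have \<phi>: "\<phi> \<in> Con ar A" "\<phi> \<noteq> Nabla A"
    and max: "\<And>\<psi>. \<psi> \<in> Con ar A \<Longrightarrow> \<phi> \<subseteq> \<psi> \<Longrightarrow> \<psi> \<noteq> Nabla A \<Longrightarrow> \<psi> = \<phi>"
    using assms(2) unfolding maximal_con_def by metis+
  have "\<alpha> \<subseteq> \<phi> \<or> \<beta> \<subseteq> \<phi>"
    if \<alpha>: "\<alpha> \<in> Con ar A" and \<beta>: "\<beta> \<in> Con ar A" and "\<alpha> \<inter> \<beta> \<subseteq> \<phi>" for \<alpha> \<beta>
  proof -
    obtain I :: "'u set" and \<kappa> where \<kappa>: "\<And>i. i \<in> I \<Longrightarrow> meet_irred ar A (\<kappa> i)"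
      and ab: "\<And>i. i \<in> I \<Longrightarrow> \<alpha> \<subseteq> \<kappa> i \<or> \<beta> \<subseteq> \<kappa> i" and "Nabla A \<inter> (\<Inter>i\<in>I. \<kappa> i) \<subseteq> \<alpha> \<inter> \<beta>"
      using meet_irred_family[OF \<alpha> \<beta>] by metis
    let ?h = "\<lambda>i. rep (\<kappa> i)"
    have "filter_con A ?h (principal I) = Nabla A \<inter> (\<Inter>i\<in>I. \<kappa> i)"
      using \<open>A \<in> V\<close> \<kappa> by (rule filter_con_rep_principal)
    then have sub: "filter_con A ?h (principal I) \<subseteq> \<phi>"
      using \<open>\<alpha> \<inter> \<beta> \<subseteq> \<phi>\<close> \<open>Nabla A \<inter> (\<Inter>i\<in>I. \<kappa> i) \<subseteq> \<alpha> \<inter> \<beta>\<close> by blast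
    interpret filtral_family ar V A I "\<lambda>i. quot A (\<kappa> i)" ?h
      using filtral_family_quot[OF \<open>A \<in> V\<close> \<kappa>] .
    obtain G where G: "G \<le> principal I" "\<phi> = filter_con A ?h G"
      using con_eq_filter_con[OF _ \<phi>(1) sub] carrier_quot by metis
    let ?F = "\<lambda>\<gamma>. filter_con A ?h (inf G (principal {i. \<gamma> \<subseteq> \<kappa> i}))"
    have Con: "?F \<gamma> \<in> Con ar A" for \<gamma>
      using A h le_infI1[OF G(1)] by (rule filter_con_Con)
    have up: "\<phi> \<subseteq> ?F \<gamma>" for \<gamma>
      unfolding G(2) by (auto simp: filter_con_iff eventually_inf_principal elim: eventually_mono)
    have le: "\<gamma> \<subseteq> ?F \<gamma>" if "\<gamma> \<in> Con ar A" for \<gamma>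
    proof clarify
      fix x y assume xy: "(x, y) \<in> \<gamma>"
      then have c: "x \<in> carrier A" "y \<in> carrier A"
        using Con_subset[OF that] by auto
      have "eventually (\<lambda>i. i \<in> {i. \<gamma> \<subseteq> \<kappa> i} \<longrightarrow> rep (\<kappa> i) x = rep (\<kappa> i) y) G"
        using eventually_in_index[OF G(1)]
      proof eventually_elim
        case (elim i)
        then have "\<kappa> i \<in> Con ar A"
          using \<kappa> by (simp add: meet_irred_def)
        then show ?case
          using rep_eq_iff[OF A _ c] xy by blast
      qed
      then show "(x, y) \<in> ?F \<gamma>"
        using c by (simp add: filter_con_iff eventually_inf_principal)
    qed
    have "?F \<alpha> \<inter> ?F \<beta> \<subseteq> \<phi>"
    proof clarify
      fix x y assume *: "(x, y) \<in> ?F \<alpha>" "(x, y) \<in> ?F \<beta>"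
      then have "eventually (\<lambda>i. i \<in> {i. \<alpha> \<subseteq> \<kappa> i} \<longrightarrow> ?h i x = ?h i y) G"
        "eventually (\<lambda>i. i \<in> {i. \<beta> \<subseteq> \<kappa> i} \<longrightarrow> ?h i x = ?h i y) G"
        by (auto simp: filter_con_iff eventually_inf_principal)
      then have "eventually (\<lambda>i. ?h i x = ?h i y) G"
        using eventually_in_index[OF G(1)] by eventually_elim (use ab in auto)
      then show "(x, y) \<in> \<phi>"
        using * unfolding G(2) by (simp add: filter_con_iff)
    qed
    then have "?F \<alpha> \<noteq> Nabla A \<or> ?F \<beta> \<noteq> Nabla A"
      using \<phi> Con_subset[OF \<phi>(1)] by auto
    then show ?thesis
      using max[OF Con up] le \<alpha> \<beta> by metis
  qed
  then show ?thesis
    using \<phi> by (simp add: Spec_def)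
qed

section \<open>Preimages and lying over in semi-degenerate filtral varieties\<close>

context
  assumes semi_deg: "semi_degenerate ar V"
begin

text \<open>The image of \<open>A\<close> in the simple algebra \<open>B/\<psi>\<close> must be
  shown simple, although it may be a proper subalgebra. If the preimage were \<open>Nabla A\<close>,
  this image would be a one-element subalgebra; semi-degeneracy would make \<open>B/\<psi>\<close>
  trivial, contradicting \<open>\<psi> \<noteq> Nabla B\<close>.\<close>

lemma pullback_maximal_con:
  assumes "A \<in> V" "B \<in> V" and f: "f \<in> homs ar A B" and "maximal_con ar B \<psi>"
  shows "maximal_con ar A (pullback A f \<psi>)"
proof -
  have A: "is_alg ar A" and B: "is_alg ar B"
    using variety_alg V assms by blast+
  have \<psi>: "\<psi> \<in> Con ar B" "\<psi> \<noteq> Nabla B"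
    using assms(4) by (auto simp: maximal_con_def)
  let ?h = "rep \<psi> \<circ> f"
  have h: "?h \<in> homs ar A (quot B \<psi>)"
    using f rep_hom[OF B \<psi>(1)] by (rule hom_comp)
  have eq: "?h a = ?h b \<longleftrightarrow> (a, b) \<in> pullback A f \<psi>" if "a \<in> carrier A" "b \<in> carrier A" for a b
    using that homsD(1)[OF f] rep_eq_iff[OF B \<psi>(1)] by (simp add: pullback_def)
  \<comment> \<open>Constant families in a power of the simple algebra \<open>B/\<psi>\<close> with an infinite exponent; the
    cofinite filter leaves every single coordinate free.\<close>
  interpret filtral_family ar V A UNIV "\<lambda>_. quot B \<psi>" "\<lambda>_. ?h"
    using filtral A variety_quot[OF V \<open>B \<in> V\<close> \<psi>(1)] quot_alg[OF B \<psi>(1)] h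
      subdirectly_irreducible_quot[OF B maximal_con_meet_irred[OF assms(4)]]
    by unfold_locales
  \<comment> \<open>On an infinite type the cofinite filter is proper, so a condition that ignores
    the index holds eventually exactly if it holds. Hence every equality between constant families
    is decided.\<close>
  have const: "eventually (\<lambda>_ :: 'u. P) cofinite \<longleftrightarrow> P" for P
    by (simp add: eventually_cofinite infinite_UNIV)
  have filter_con: "filter_con A (\<lambda>_ :: 'u. ?h) cofinite = pullback A f \<psi>"
    using eq by (auto simp: filter_con_iff const pullback_def)
  have "pullback A f \<psi> \<noteq> Nabla A"
  proof
    assume all: "pullback A f \<psi> = Nabla A"
    obtain a where a: "a \<in> carrier A"
      using is_algD(1)[OF A] by blast
    have "oper (quot B \<psi>) g xs = ?h a" if "length xs = ar g" "set xs \<subseteq> {?h a}" for g xs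
    proof -
      have "xs = map ?h (replicate (ar g) a)"
        using that by (metis map_replicate replicate_eqI singletonD subsetD)
      moreover have "set (replicate (ar g) a) \<subseteq> carrier A"
        using a by auto
      ultimately have "oper (quot B \<psi>) g xs = ?h (oper A g (replicate (ar g) a))"
        using homsD(2)[OF h] by simp
      also have "\<dots> = ?h a"
        using eq[of "oper A g (replicate (ar g) a)" a] is_algD(2)[OF A] a all
        by (simp add: set_replicate_conv_if)
      finally show ?thesis .
    qed
    then have "subuniverse ar (quot B \<psi>) {?h a}"
      using homsD(1)[OF h a] by (simp add: subuniverse_def)
    then obtain m where m: "carrier (quot B \<psi>) = {m}"
      using semi_deg variety_quot[OF V \<open>B \<in> V\<close> \<psi>(1)] unfolding semi_degenerate_def by blast
    have "(x, y) \<in> \<psi>" if "x \<in> carrier B" "y \<in> carrier B" for x y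
      using rep_eq_iff[OF B \<psi>(1) that] that m carrier_quot[of B \<psi>] by force
    then show False
      using \<psi> Con_subset[OF \<psi>(1)] by auto
  qed
  then have "maximal_con ar A (filter_con A (\<lambda>_ :: 'u. ?h) cofinite)"
    by (intro maximal_filter_con) (auto simp: const filter_con eventually_cofinite)
  then show ?thesis
    by (simp only: filter_con)
qed

lemma filtral_LO:
  assumes "A \<in> V" "B \<in> V" and f: "f \<in> homs ar A B"
  shows "fulfills_LO ar A B f"
  unfolding fulfills_LO_def
proof (intro ballI impI)
  fix \<phi> assume \<phi>: "\<phi> \<in> Spec ar A" and Ker: "Ker A B f \<subseteq> \<phi>"
  have A: "is_alg ar A" and B: "is_alg ar B"
    using variety_alg V assms by blast+
  obtain I :: "'u set" and \<kappa> where \<kappa>: "\<And>i. i \<in> I \<Longrightarrow> meet_irred ar B (\<kappa> i)"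
    and "Nabla B \<inter> (\<Inter>i\<in>I. \<kappa> i) \<subseteq> Delta B \<inter> Delta B"
    using meet_irred_family[OF Delta_Con[OF B] Delta_Con[OF B]] by metis
  let ?\<mu> = "\<lambda>i. pullback A f (\<kappa> i)"
  have \<mu>: "meet_irred ar A (?\<mu> i)" if "i \<in> I" for i
    using pullback_maximal_con[OF assms meet_irred_maximal_con[OF \<open>B \<in> V\<close> \<kappa>[OF that]]]
    by (rule maximal_con_meet_irred)
  \<comment> \<open>Pulling back commutes with intersections: preimages of a family that intersects
    to equality on \<open>B\<close> intersect to the kernel of \<open>f\<close>.\<close>
  have "(x, y) \<in> \<phi>" if "(x, y) \<in> Nabla A \<inter> (\<Inter>i\<in>I. ?\<mu> i)" for x y
  proof -
    have "(f x, f y) \<in> Nabla B \<inter> (\<Inter>i\<in>I. \<kappa> i)"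
      using that homsD(1)[OF f] by (auto simp: pullback_def)
    then have "(x, y) \<in> Ker A B f"
      using that \<open>Nabla B \<inter> (\<Inter>i\<in>I. \<kappa> i) \<subseteq> Delta B \<inter> Delta B\<close> by (auto simp: Ker_def pullback_def)
    then show ?thesis
      using Ker by blast
  qed
  moreover have "filter_con A (\<lambda>i. rep (?\<mu> i)) (principal I) = Nabla A \<inter> (\<Inter>i\<in>I. ?\<mu> i)"
    using \<open>A \<in> V\<close> \<mu> by (rule filter_con_rep_principal)
  ultimately have sub: "filter_con A (\<lambda>i. rep (?\<mu> i)) (principal I) \<subseteq> \<phi>"
    by auto
  interpret A: filtral_family ar V A I "\<lambda>i. quot A (?\<mu> i)" "\<lambda>i. rep (?\<mu> i)"
    using filtral_family_quot[OF \<open>A \<in> V\<close> \<mu>] .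
  interpret B: filtral_family ar V B I "\<lambda>i. quot B (\<kappa> i)" "\<lambda>i. rep (\<kappa> i)"
    using filtral_family_quot[OF \<open>B \<in> V\<close> \<kappa>] .
  obtain G where G: "G \<le> principal I" "\<phi> = filter_con A (\<lambda>i. rep (?\<mu> i)) G"
    "\<And>P. eventually P G \<or> eventually (\<lambda>i. \<not> P i) G"
    using A.Spec_eq_ultrafilter_con[OF _ \<phi> sub] carrier_quot by metis
  \<comment> \<open>The same filter is read on \<open>B\<close>. By the definition of
    \<open>?\<mu> i\<close>, the elements \<open>x\<close> and \<open>y\<close> agree modulo
    \<open>?\<mu> i\<close> exactly if \<open>f x\<close> and \<open>f y\<close> agree modulo
    \<open>\<kappa> i\<close>.\<close>
  let ?\<phi>1 = "filter_con B (\<lambda>i. rep (\<kappa> i)) G"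
  have "eventually (\<lambda>i. rep (\<kappa> i) (f x) = rep (\<kappa> i) (f y)) G \<longleftrightarrow>
      eventually (\<lambda>i. rep (?\<mu> i) x = rep (?\<mu> i) y) G"
    if c: "x \<in> carrier A" "y \<in> carrier A" for x y
  proof (rule eventually_subst, use eventually_in_index[OF G(1)] in eventually_elim)
    case (elim i)
    then have "\<kappa> i \<in> Con ar B" "?\<mu> i \<in> Con ar A"
      using \<kappa> \<mu> by (simp_all add: meet_irred_def)
    then show ?case
      using c homsD(1)[OF f] by (simp add: rep_eq_iff[OF A] rep_eq_iff[OF B] pullback_def)
  qed
  then have pb: "pullback A f ?\<phi>1 = \<phi>"
    using homsD(1)[OF f] by (auto simp: G(2) pullback_def filter_con_iff)
  have "?\<phi>1 \<noteq> Nabla B"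
  proof
    assume "?\<phi>1 = Nabla B"
    then have "\<phi> = Nabla A"
      using homsD(1)[OF f] unfolding pb[symmetric] by (auto simp: pullback_def)
    then show False
      using \<phi> by (simp add: Spec_def)
  qed
  then have "maximal_con ar B ?\<phi>1"
    using G(3) by (intro B.maximal_filter_con[OF G(1)]) (auto simp: carrier_quot)
  then show "\<exists>\<phi>1\<in>Spec ar B. pullback A f \<phi>1 = \<phi>"
    using maximal_con_Spec[OF \<open>B \<in> V\<close>] pb by blast
qed

lemma filtral_admissible:
  assumes "A \<in> V" "B \<in> V" "f \<in> homs ar A B"
  shows "admissible ar A B f"
  using pullback_maximal_con[OF assms] Spec_maximal_con[OF \<open>B \<in> V\<close>] maximal_con_Spec[OF \<open>A \<in> V\<close>]
  unfolding admissible_def by blast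

end

lemma filtral_GU:
  assumes "A \<in> V"
  shows "fulfills_GU ar A B f"
  unfolding fulfills_GU_def
proof (intro ballI impI)
  fix \<phi> \<psi> \<phi>1
  assume *: "\<phi> \<in> Spec ar A" "\<psi> \<in> Spec ar A" "\<phi>1 \<in> Spec ar B" "\<phi> \<subseteq> \<psi> \<and> pullback A f \<phi>1 = \<phi>"
  then have "\<psi> = \<phi>"
    using Spec_maximal_con[OF assms *(1)] by (auto simp: maximal_con_def Spec_def)
  then show "\<exists>\<psi>1\<in>Spec ar B. \<phi>1 \<subseteq> \<psi>1 \<and> pullback A f \<psi>1 = \<psi>"
    using * by blast
qed

end

section \<open>Discriminator varieties are filtral\<close>

lemma trm_val_product_alg:
  "i \<in> I \<Longrightarrow> trm_val ((product_alg I M)\<lparr>carrier := S\<rparr>) \<rho> t i = trm_val (M i) (\<lambda>v. \<rho> v i) t"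
proof (induction t)
  case (App g ts)
  let ?Q = "(product_alg I M)\<lparr>carrier := S\<rparr>"
  have "oper ?Q g xs i = oper (M i) g (map (\<lambda>x. x i) xs)" for xs
    using App.prems by (simp add: product_alg_def)
  moreover have "map (\<lambda>x. x i) (map (trm_val ?Q \<rho>) ts) = map (trm_val (M i) (\<lambda>v. \<rho> v i)) ts"
    using App by auto
  ultimately show ?case
    by (simp add: comp_def cong: map_cong)
qed simp

text \<open>The filter is generated by the equality sets of the pairs in \<open>\<theta>\<close>.
  Since membership in it depends on finitely many generators, the core is \<open>fin\<close>:
  elements that agree wherever finitely many pairs of \<open>\<theta>\<close> agree are congruent.
  The discriminator term, which acts coordinatewise, eliminates these pairs one by one.\<close>

lemma discriminator_filtral:
  fixes ar :: "'f \<Rightarrow> nat" and V :: "('f, 'u) alg set"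
  assumes "discriminator ar V"
  shows "filtral ar V"
  unfolding filtral_def
proof (intro allI impI ballI)
  fix I :: "'u set" and M :: "'u \<Rightarrow> ('f, 'u) alg" and S \<theta>
  let ?Q = "(product_alg I M)\<lparr>carrier := S\<rparr>"
  assume *: "(\<forall>i\<in>I. M i \<in> V \<and> subdirectly_irreducible ar (M i)) \<and> subdirect_product ar I M S"
    and \<theta>: "\<theta> \<in> Con ar ?Q"
  obtain t :: "('f, nat) trm" where wf: "wf_trm ar t" and
    t: "\<And>M a b c. M \<in> V \<Longrightarrow> subdirectly_irreducible ar M \<Longrightarrow>
      a \<in> carrier M \<Longrightarrow> b \<in> carrier M \<Longrightarrow> c \<in> carrier M \<Longrightarrow>
      trm_val M ((\<lambda>_. c)(0 := a, 1 := b)) t = (if a \<noteq> b then a else c)"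
    using assms unfolding discriminator_def by blast
  have S: "S \<noteq> {}" "S \<subseteq> (\<Pi>\<^sub>E i\<in>I. carrier (M i))"
    "\<And>g xs. length xs = ar g \<Longrightarrow> set xs \<subseteq> S \<Longrightarrow> oper (product_alg I M) g xs \<in> S"
    using * by (auto simp: subdirect_product_def subuniverse_def product_alg_def)
  have Q: "is_alg ar ?Q"
    using S by (simp add: is_alg_def)
  define d where "d a b c = trm_val ?Q ((\<lambda>_. c)(0 := a, 1 := b)) t" for a b c
  have d_S: "d a b c \<in> S" if "a \<in> S" "b \<in> S" "c \<in> S" for a b c
    using trm_val_carrier[OF Q wf, of "(\<lambda>_. c)(0 := a, 1 := b)"] that by (auto simp: d_def)
  have d: "d a b c i = (if a i \<noteq> b i then a i else c i)"
    if "a \<in> S" "b \<in> S" "c \<in> S" "i \<in> I" for a b c i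
  proof -
    have "d a b c i = trm_val (M i) ((\<lambda>_. c i)(0 := a i, 1 := b i)) t"
      unfolding d_def trm_val_product_alg[OF \<open>i \<in> I\<close>]
      by (rule arg_cong[where f = "\<lambda>\<rho>. trm_val (M i) \<rho> t"]) auto
    moreover have "a i \<in> carrier (M i)" "b i \<in> carrier (M i)" "c i \<in> carrier (M i)"
      using that S(2) by auto
    ultimately show ?thesis
      using t[of "M i" "a i" "b i" "c i"] * \<open>i \<in> I\<close> by simp
  qed
  have eqI: "x = y" if "x \<in> S" "y \<in> S" "\<And>i. i \<in> I \<Longrightarrow> x i = y i" for x y
    using that S(2) by (metis PiE_ext subsetD)
  have \<theta>_S: "\<theta> \<subseteq> S \<times> S"
    using Con_subset[OF \<theta>] by simp
  \<comment> \<open>Modulo \<open>\<theta>\<close> the first argument \<open>a\<close> may be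
    replaced by \<open>b\<close>, and for equal first arguments the discriminator returns the
    third.\<close>
  have d_\<theta>: "(d a b c, c) \<in> \<theta>" if "(a, b) \<in> \<theta>" "c \<in> S" for a b c
  proof -
    have c: "a \<in> S" "b \<in> S"
      using that(1) \<theta>_S by auto
    have "d b b c = c"
      using c that d_S d by (intro eqI) auto
    moreover have "(d a b c, d b b c) \<in> \<theta>"
      unfolding d_def using that c Con_refl[OF \<theta>] by (intro trm_val_Con[OF \<theta> _ wf]) simp
    ultimately show ?thesis
      by simp
  qed
  have fin: "\<forall>c\<in>S. \<forall>e\<in>S. (\<forall>i\<in>I. (\<forall>p\<in>X. fst p i = snd p i) \<longrightarrow> c i = e i) \<longrightarrow> (c, e) \<in> \<theta>"
    if "finite X" "X \<subseteq> \<theta>" for X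
    using that
  proof (induction X)
    case empty
    then show ?case
      using Con_refl[OF \<theta>] eqI by fastforce
  next
    case (insert p X)
    obtain a b where p: "p = (a, b)"
      by fastforce
    have ab: "(a, b) \<in> \<theta>" "a \<in> S" "b \<in> S"
      using insert.prems \<theta>_S p by auto
    show ?case
    proof (intro ballI impI)
      fix c e assume c: "c \<in> S" "e \<in> S"
        and eq: "\<forall>i\<in>I. (\<forall>q\<in>insert p X. fst q i = snd q i) \<longrightarrow> c i = e i"
      \<comment> \<open>Replacing \<open>c, e\<close> by \<open>d a b c, d a b e\<close> makes them equal wherever \<open>a, b\<close> differ.\<close>
      have "\<forall>i\<in>I. (\<forall>q\<in>X. fst q i = snd q i) \<longrightarrow> d a b c i = d a b e i"
        using eq p d ab c by simp
      then have "(d a b c, d a b e) \<in> \<theta>"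
        using insert c ab d_S by simp
      moreover have "(d a b c, c) \<in> \<theta>" "(d a b e, e) \<in> \<theta>"
        using d_\<theta> ab c by auto
      ultimately show "(c, e) \<in> \<theta>"
        by (meson Con_sym[OF \<theta>] Con_trans[OF \<theta>])
    qed
  qed
  define P where "P p = {i \<in> I. fst p i = snd p i}" for p :: "('u \<Rightarrow> 'u) \<times> ('u \<Rightarrow> 'u)"
  define F where "F = inf (principal I) (INF p\<in>\<theta>. principal (P p))"
  have ev: "eventually (\<lambda>i. i \<in> I \<and> a i = b i) F \<longleftrightarrow> (a, b) \<in> \<theta>" if c: "a \<in> S" "b \<in> S" for a b
  proof
    assume "(a, b) \<in> \<theta>"
    then have "F \<le> principal (P (a, b))"
      unfolding F_def by (meson INF_lower inf.coboundedI2)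
    then show "eventually (\<lambda>i. i \<in> I \<and> a i = b i) F"
      by (simp add: le_principal P_def)
  next
    assume "eventually (\<lambda>i. i \<in> I \<and> a i = b i) F"
    then have "eventually (\<lambda>i. i \<in> I \<longrightarrow> a i = b i) (INF p\<in>\<theta>. principal (P p))"
      unfolding F_def inf.commute[of "principal I"] eventually_inf_principal
      by (auto elim: eventually_mono)
    then obtain X where X: "X \<subseteq> \<theta>" "finite X"
      "eventually (\<lambda>i. i \<in> I \<longrightarrow> a i = b i) (INF p\<in>X. principal (P p))"
      unfolding eventually_INF[of _ _ \<theta>] by blast
    then have "\<forall>i\<in>I. (\<forall>p\<in>X. fst p i = snd p i) \<longrightarrow> a i = b i"
      by (auto simp: INF_principal_finite eventually_principal P_def)
    then show "(a, b) \<in> \<theta>"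
      using fin[OF X(2,1)] c by blast
  qed
  have "\<theta> = {(a, b) \<in> S \<times> S. eventually (\<lambda>i. i \<in> I \<and> a i = b i) F}"
    using ev \<theta>_S by auto
  moreover have "F \<le> principal I"
    by (simp add: F_def)
  ultimately show "\<exists>F\<le>principal I. \<theta> = {(a, b) \<in> S \<times> S. eventually (\<lambda>i. i \<in> I \<and> a i = b i) F}"
    by blast
qed

section \<open>Filters of lattice-ordered monoids\<close>

text \<open>The common ground of (i) and (ii): \<open>mult\<close> is the monoid product of a
  residuated lattice, or the meet of a distributive lattice. Distributivity of \<open>mult\<close>
  over joins is what the prime filter theorem relies on.\<close>

locale lattice_monoid =
  fixes R :: "'a set" and join :: "'a \<Rightarrow> 'a \<Rightarrow> 'a" (infixl "\<squnion>" 65)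
    and mult :: "'a \<Rightarrow> 'a \<Rightarrow> 'a" (infixl "\<odot>" 70) and tp :: 'a
  assumes join_closed [simp]: "x \<in> R \<Longrightarrow> y \<in> R \<Longrightarrow> x \<squnion> y \<in> R"
    and mult_closed [simp]: "x \<in> R \<Longrightarrow> y \<in> R \<Longrightarrow> x \<odot> y \<in> R"
    and tp_closed [simp]: "tp \<in> R"
    and join_comm: "x \<in> R \<Longrightarrow> y \<in> R \<Longrightarrow> x \<squnion> y = y \<squnion> x"
    and join_assoc: "x \<in> R \<Longrightarrow> y \<in> R \<Longrightarrow> z \<in> R \<Longrightarrow> x \<squnion> y \<squnion> z = x \<squnion> (y \<squnion> z)"
    and join_idem [simp]: "x \<in> R \<Longrightarrow> x \<squnion> x = x"
    and mult_comm: "x \<in> R \<Longrightarrow> y \<in> R \<Longrightarrow> x \<odot> y = y \<odot> x"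
    and mult_assoc: "x \<in> R \<Longrightarrow> y \<in> R \<Longrightarrow> z \<in> R \<Longrightarrow> x \<odot> y \<odot> z = x \<odot> (y \<odot> z)"
    and mult_tp [simp]: "x \<in> R \<Longrightarrow> x \<odot> tp = x"
    and join_tp [simp]: "x \<in> R \<Longrightarrow> x \<squnion> tp = tp"
    and mult_join: "x \<in> R \<Longrightarrow> y \<in> R \<Longrightarrow> z \<in> R \<Longrightarrow> x \<odot> (y \<squnion> z) = x \<odot> y \<squnion> x \<odot> z"
begin

definition le :: "'a \<Rightarrow> 'a \<Rightarrow> bool" (infix "\<sqsubseteq>" 50) where
  "x \<sqsubseteq> y \<longleftrightarrow> x \<squnion> y = y"

lemma le_refl [simp]: "x \<in> R \<Longrightarrow> x \<sqsubseteq> x"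
  by (simp add: le_def)

lemma le_antisym: "x \<in> R \<Longrightarrow> y \<in> R \<Longrightarrow> x \<sqsubseteq> y \<Longrightarrow> y \<sqsubseteq> x \<Longrightarrow> x = y"
  by (metis le_def join_comm)

lemma le_trans: "x \<in> R \<Longrightarrow> y \<in> R \<Longrightarrow> z \<in> R \<Longrightarrow> x \<sqsubseteq> y \<Longrightarrow> y \<sqsubseteq> z \<Longrightarrow> x \<sqsubseteq> z"
  by (metis le_def join_assoc)

lemma le_tp [simp]: "x \<in> R \<Longrightarrow> x \<sqsubseteq> tp"
  by (simp add: le_def)

lemma le_join1 [simp]: "x \<in> R \<Longrightarrow> y \<in> R \<Longrightarrow> x \<sqsubseteq> x \<squnion> y"
  by (simp add: le_def join_assoc[symmetric])

lemma le_join2 [simp]: "x \<in> R \<Longrightarrow> y \<in> R \<Longrightarrow> y \<sqsubseteq> x \<squnion> y"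
  by (metis le_join1 join_comm)

lemma join_least: "x \<in> R \<Longrightarrow> y \<in> R \<Longrightarrow> z \<in> R \<Longrightarrow> x \<sqsubseteq> z \<Longrightarrow> y \<sqsubseteq> z \<Longrightarrow> x \<squnion> y \<sqsubseteq> z"
  by (simp add: le_def join_assoc)

lemma join_mono:
  assumes "x \<in> R" "y \<in> R" "x' \<in> R" "y' \<in> R" "x \<sqsubseteq> x'" "y \<sqsubseteq> y'"
  shows "x \<squnion> y \<sqsubseteq> x' \<squnion> y'"
  using assms by (meson join_closed join_least le_join1 le_join2 le_trans)

lemma mult_mono1: "x \<in> R \<Longrightarrow> y \<in> R \<Longrightarrow> z \<in> R \<Longrightarrow> y \<sqsubseteq> z \<Longrightarrow> x \<odot> y \<sqsubseteq> x \<odot> z"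
  by (metis le_def mult_join)

lemma mult_mono:
  assumes "x \<in> R" "y \<in> R" "x' \<in> R" "y' \<in> R" "x \<sqsubseteq> x'" "y \<sqsubseteq> y'"
  shows "x \<odot> y \<sqsubseteq> x' \<odot> y'"
  using assms by (metis mult_closed mult_comm mult_mono1 le_trans)

lemma mult_le1 [simp]: "x \<in> R \<Longrightarrow> y \<in> R \<Longrightarrow> x \<odot> y \<sqsubseteq> x"
  by (metis le_tp mult_mono1 mult_tp tp_closed)

lemma mult_le2 [simp]: "x \<in> R \<Longrightarrow> y \<in> R \<Longrightarrow> x \<odot> y \<sqsubseteq> y"
  by (metis mult_comm mult_le1)

definition is_filter :: "'a set \<Rightarrow> bool" where
  "is_filter F \<longleftrightarrow> F \<subseteq> R \<and> tp \<in> F \<and> (\<forall>x\<in>F. \<forall>y\<in>F. x \<odot> y \<in> F) \<and>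
     (\<forall>x\<in>F. \<forall>y\<in>R. x \<sqsubseteq> y \<longrightarrow> y \<in> F)"

definition prime_filter :: "'a set \<Rightarrow> bool" where
  "prime_filter P \<longleftrightarrow> is_filter P \<and> P \<noteq> R \<and>
     (\<forall>x\<in>R. \<forall>y\<in>R. x \<squnion> y \<in> P \<longrightarrow> x \<in> P \<or> y \<in> P)"

lemma is_filterD:
  assumes "is_filter F"
  shows "x \<in> F \<Longrightarrow> x \<in> R" "tp \<in> F" "x \<in> F \<Longrightarrow> y \<in> F \<Longrightarrow> x \<odot> y \<in> F"
    "x \<in> F \<Longrightarrow> y \<in> R \<Longrightarrow> x \<sqsubseteq> y \<Longrightarrow> y \<in> F"
  using assms by (auto simp: is_filter_def)

lemma is_filterI:
  assumes "F \<subseteq> R" "tp \<in> F" "\<And>x y. x \<in> F \<Longrightarrow> y \<in> F \<Longrightarrow> x \<odot> y \<in> F"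
    "\<And>x y. x \<in> F \<Longrightarrow> y \<in> R \<Longrightarrow> x \<sqsubseteq> y \<Longrightarrow> y \<in> F"
  shows "is_filter F"
  using assms by (auto simp: is_filter_def)

text \<open>Residuals \<open>{z. z \<squnion> y \<in> F}\<close> replace the filters generated by \<open>F\<close> and one more element, so that
  no powers are needed.\<close>

lemma is_filter_residual:
  assumes F: "is_filter F" and y: "y \<in> R"
  shows "is_filter {z \<in> R. z \<squnion> y \<in> F}"
proof (rule is_filterI)
  fix z w assume z: "z \<in> {z \<in> R. z \<squnion> y \<in> F}" and w: "w \<in> {z \<in> R. z \<squnion> y \<in> F}"
  \<comment> \<open>After multiplying out, every summand except \<open>z \<odot> w\<close> has a
    factor \<open>y\<close> and hence lies below \<open>y\<close>.\<close>
  have "(z \<squnion> y) \<odot> (w \<squnion> y) = (z \<squnion> y) \<odot> w \<squnion> (z \<squnion> y) \<odot> y"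
    using z w y by (simp add: mult_join)
  also have "\<dots> \<sqsubseteq> z \<odot> w \<squnion> y"
  proof (rule join_least)
    have "(z \<squnion> y) \<odot> w = z \<odot> w \<squnion> y \<odot> w"
      using z w y by (simp add: mult_comm[of _ w] mult_join)
    also have "\<dots> \<sqsubseteq> z \<odot> w \<squnion> y"
      using z w y by (intro join_mono) auto
    finally show "(z \<squnion> y) \<odot> w \<sqsubseteq> z \<odot> w \<squnion> y" .
    show "(z \<squnion> y) \<odot> y \<sqsubseteq> z \<odot> w \<squnion> y"
      using z w y le_trans[of "(z \<squnion> y) \<odot> y" y "z \<odot> w \<squnion> y"] by simp
  qed (use z w y in auto)
  finally have "(z \<squnion> y) \<odot> (w \<squnion> y) \<sqsubseteq> z \<odot> w \<squnion> y" .
  moreover have "(z \<squnion> y) \<odot> (w \<squnion> y) \<in> F"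
    using is_filterD(3)[OF F] z w by simp
  ultimately show "z \<odot> w \<in> {z \<in> R. z \<squnion> y \<in> F}"
    using is_filterD(4)[OF F, of "(z \<squnion> y) \<odot> (w \<squnion> y)" "z \<odot> w \<squnion> y"] z w y by simp
next
  fix z w assume z: "z \<in> {z \<in> R. z \<squnion> y \<in> F}" and w: "w \<in> R" "z \<sqsubseteq> w"
  then have "z \<squnion> y \<sqsubseteq> w \<squnion> y"
    using y by (intro join_mono) auto
  then show "w \<in> {z \<in> R. z \<squnion> y \<in> F}"
    using is_filterD(4)[OF F, of "z \<squnion> y" "w \<squnion> y"] z w y by simp
qed (use y is_filterD(2)[OF F] join_comm[of tp y] in auto)

lemma residual_superset: "is_filter F \<Longrightarrow> y \<in> R \<Longrightarrow> F \<subseteq> {z \<in> R. z \<squnion> y \<in> F}"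
  using is_filterD(1,4)[of F] le_join1 join_closed by blast

text \<open>Let \<open>P\<close> be maximal among the filters above \<open>F\<close> that avoid
  \<open>S\<close>, and let \<open>x \<squnion> y\<close> be in \<open>P\<close>. The residual of
  \<open>P\<close> by \<open>y\<close> contains \<open>P\<close> and \<open>x\<close>, so either
  \<open>x\<close> is in \<open>P\<close> or some \<open>s\<close> in \<open>S\<close> has
  \<open>s \<squnion> y\<close> in \<open>P\<close>. Repeating this with \<open>y\<close> and
  \<open>s\<close> gives \<open>y\<close> in \<open>P\<close>, or \<open>t \<squnion> s\<close> in
  \<open>P\<close> for some \<open>t\<close> in \<open>S\<close>; the latter contradicts closure of
  \<open>S\<close> under joins.\<close>

lemma prime_filter_separation:
  assumes F: "is_filter F" and S: "S \<subseteq> R" "S \<noteq> {}" "\<And>s t. s \<in> S \<Longrightarrow> t \<in> S \<Longrightarrow> s \<squnion> t \<in> S"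
    and disj: "F \<inter> S = {}"
  obtains P where "prime_filter P" "F \<subseteq> P" "P \<inter> S = {}"
proof -
  let ?A = "{P. is_filter P \<and> F \<subseteq> P \<and> P \<inter> S = {}}"
  have "\<exists>P\<in>?A. \<forall>Q\<in>?A. P \<subseteq> Q \<longrightarrow> Q = P"
  proof (rule subset_Zorn_nonempty)
    show "?A \<noteq> {}"
      using F disj by blast
    fix \<C> assume \<C>: "\<C> \<noteq> {}" "subset.chain ?A \<C>"
    then have sub: "\<C> \<subseteq> ?A" and ch: "\<And>P Q. P \<in> \<C> \<Longrightarrow> Q \<in> \<C> \<Longrightarrow> P \<subseteq> Q \<or> Q \<subseteq> P"
      by (auto simp: subset_chain_def)
    have fil: "is_filter P" if "P \<in> \<C>" for P
      using sub that by auto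
    have "is_filter (\<Union>\<C>)"
    proof (rule is_filterI)
      show "tp \<in> \<Union>\<C>"
        using \<C>(1) fil is_filterD(2) by blast
      show "x \<odot> y \<in> \<Union>\<C>" if xy: "x \<in> \<Union>\<C>" "y \<in> \<Union>\<C>" for x y
      proof -
        obtain P where "P \<in> \<C>" "x \<in> P" "y \<in> P"
          using xy ch by blast
        then show ?thesis
          using fil is_filterD(3) by blast
      qed
    qed (use fil is_filterD in blast)+
    then show "\<Union>\<C> \<in> ?A"
      using sub \<C>(1) by blast
  qed
  then obtain P where P: "is_filter P" "F \<subseteq> P" "P \<inter> S = {}"
    and max: "\<And>Q. is_filter Q \<Longrightarrow> P \<subseteq> Q \<Longrightarrow> Q \<inter> S = {} \<Longrightarrow> Q = P"
    by (elim bexE) auto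
  have step: "(\<exists>s\<in>S. s \<squnion> y \<in> P) \<or> x \<in> P" if "x \<in> R" "y \<in> R" "x \<squnion> y \<in> P" for x y
  proof (cases "{z \<in> R. z \<squnion> y \<in> P} \<inter> S = {}")
    case True
    then have "{z \<in> R. z \<squnion> y \<in> P} = P"
      using max[OF is_filter_residual[OF P(1) that(2)] residual_superset[OF P(1) that(2)]] by simp
    then show ?thesis
      using that by blast
  qed blast
  have "x \<in> P \<or> y \<in> P" if xy: "x \<in> R" "y \<in> R" "x \<squnion> y \<in> P" for x y
  proof (rule ccontr)
    assume n: "\<not> (x \<in> P \<or> y \<in> P)"
    then obtain s where s: "s \<in> S" "s \<squnion> y \<in> P"
      using step[OF xy] by blast
    then have sR: "s \<in> R"
      using S(1) by blast
    then have "y \<squnion> s \<in> P"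
      using s(2) xy(2) join_comm by metis
    then obtain t where "t \<in> S" "t \<squnion> s \<in> P"
      using step[OF xy(2) sR] n by blast
    then show False
      using S(3) s(1) P(3) by blast
  qed
  moreover have "P \<noteq> R"
    using P(3) S by blast
  ultimately have "prime_filter P"
    using P(1) unfolding prime_filter_def by blast
  then show ?thesis
    using that P(2,3) by blast
qed

end

lemma prime_filter_lying_over:
  assumes A: "lattice_monoid RA jA mA tA" and B: "lattice_monoid RB jB mB tB"
    and f: "\<And>x. x \<in> RA \<Longrightarrow> f x \<in> RB"
    and f_join: "\<And>x y. x \<in> RA \<Longrightarrow> y \<in> RA \<Longrightarrow> f (jA x y) = jB (f x) (f y)"
    and f_mult: "\<And>x y. x \<in> RA \<Longrightarrow> y \<in> RA \<Longrightarrow> f (mA x y) = mB (f x) (f y)"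
    and f_top: "f tA = tB"
    and Q: "lattice_monoid.prime_filter RA jA mA tA Q"
    and P1: "lattice_monoid.is_filter RB jB mB tB P1"
    and sep: "\<And>p q a. p \<in> P1 \<Longrightarrow> q \<in> Q \<Longrightarrow> a \<in> RA \<Longrightarrow>
      lattice_monoid.le jB (mB p (f q)) (f a) \<Longrightarrow> a \<in> Q"
  obtains Q1 where "lattice_monoid.prime_filter RB jB mB tB Q1" "P1 \<subseteq> Q1"
    "{x \<in> RA. f x \<in> Q1} = Q"
proof -
  interpret A: lattice_monoid RA jA mA tA by fact
  interpret B: lattice_monoid RB jB mB tB by fact
  \<comment> \<open>Since \<open>P1\<close> and \<open>Q\<close> are both closed under products and
    \<open>mult\<close> is commutative, products of one factor from each side suffice to generate
    the filter.\<close>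
  let ?F = "{z \<in> RB. \<exists>p\<in>P1. \<exists>q\<in>Q. B.le (mB p (f q)) z}"
  have fQ: "A.is_filter Q" and "Q \<noteq> RA"
    and prime: "\<And>x y. x \<in> RA \<Longrightarrow> y \<in> RA \<Longrightarrow> jA x y \<in> Q \<Longrightarrow> x \<in> Q \<or> y \<in> Q"
    using Q unfolding A.prime_filter_def by auto
  note Qd = A.is_filterD[OF fQ] and Pd = B.is_filterD[OF P1]
  have "B.is_filter ?F"
  proof (rule B.is_filterI)
    show "tB \<in> ?F"
      using Qd(1,2) Pd(1,2) f B.le_tp B.mult_closed B.tp_closed by blast
    fix z w
    show "mB z w \<in> ?F" if z: "z \<in> ?F" and w: "w \<in> ?F"
    proof -
      obtain p q where p: "p \<in> P1" "q \<in> Q" "B.le (mB p (f q)) z"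
        using z by blast
      obtain p' q' where p': "p' \<in> P1" "q' \<in> Q" "B.le (mB p' (f q')) w"
        using w by blast
      have R: "p \<in> RB" "p' \<in> RB" "q \<in> RA" "q' \<in> RA" "f q \<in> RB" "f q' \<in> RB"
        using p p' Pd(1) Qd(1) f by auto
      have "mB (mB p p') (f (mA q q')) = mB (mB p (f q)) (mB p' (f q'))"
        using R by (simp add: f_mult) (smt (verit) B.mult_assoc B.mult_closed B.mult_comm)
      also have "B.le \<dots> (mB z w)"
        using R p p' z w by (intro B.mult_mono) auto
      finally show ?thesis
        using Pd(3)[OF p(1) p'(1)] Qd(3)[OF p(2) p'(2)] z w B.mult_closed[of z w] by blast
    qed
    show "w \<in> ?F" if z: "z \<in> ?F" and "w \<in> RB" "B.le z w"
    proof -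
      obtain p q where p: "p \<in> P1" "q \<in> Q" "B.le (mB p (f q)) z"
        using z by blast
      then have "mB p (f q) \<in> RB"
        using Pd(1) Qd(1) f by auto
      then have "B.le (mB p (f q)) w"
        using B.le_trans p(3) that by blast
      then show ?thesis
        using p that by blast
    qed
  qed blast
  moreover have "f ` (RA - Q) \<subseteq> RB" "f ` (RA - Q) \<noteq> {}"
    using f \<open>Q \<noteq> RA\<close> Qd(1) by auto
  moreover have "jB s t \<in> f ` (RA - Q)" if s: "s \<in> f ` (RA - Q)" and t: "t \<in> f ` (RA - Q)" for s t
  proof -
    obtain x y where "x \<in> RA - Q" "y \<in> RA - Q" "s = f x" "t = f y"
      using s t by blast
    then show ?thesis
      using prime f_join by (intro image_eqI[of _ _ "jA x y"]) auto
  qed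
  moreover have "?F \<inter> f ` (RA - Q) = {}"
    using sep by blast
  ultimately obtain Q1 where Q1: "B.prime_filter Q1" "?F \<subseteq> Q1" "Q1 \<inter> f ` (RA - Q) = {}"
    by (rule B.prime_filter_separation)
  have "P1 \<subseteq> ?F"
  proof
    fix p assume p: "p \<in> P1"
    then have "B.le (mB p (f tA)) p"
      using Pd(1) by (simp add: f_top)
    then show "p \<in> ?F"
      using p Pd(1) Qd(2) by blast
  qed
  moreover have "f q \<in> ?F" if "q \<in> Q" for q
  proof -
    have "B.le (mB tB (f q)) (f q)"
      using that Qd(1) f by simp
    then show ?thesis
      using that Qd(1) Pd(2) f by blast
  qed
  ultimately show ?thesis
    using that[OF Q1(1)] Q1(2,3) Qd(1) by blast
qed

lemma bounded_lattice_on_idem: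
  "bounded_lattice_on R j m bt tp \<Longrightarrow> x \<in> R \<Longrightarrow> j x x = x \<and> m x x = x"
  unfolding bounded_lattice_on_def by metis

lemma bounded_lattice_on_tp:
  "bounded_lattice_on R j m bt tp \<Longrightarrow> x \<in> R \<Longrightarrow> j x tp = tp \<and> m x bt = bt"
  unfolding bounded_lattice_on_def by metis

lemma length_2_iff: "length xs = 2 \<longleftrightarrow> (\<exists>x y. xs = [x, y])"
  by (auto simp: numeral_2_eq_2 length_Suc_conv)

section \<open>Residuated lattices\<close>

locale resid_lattice =
  fixes M :: "(rl_sym, 'a) alg"
  assumes rl: "residuated_lattice M"
begin

abbreviation "R \<equiv> carrier M"
abbreviation join (infixl "\<squnion>" 65) where "x \<squnion> y \<equiv> oper M RJoin [x, y]"
abbreviation meet (infixl "\<sqinter>" 70) where "x \<sqinter> y \<equiv> oper M RMeet [x, y]"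
abbreviation mult (infixl "\<odot>" 70) where "x \<odot> y \<equiv> oper M RMult [x, y]"
abbreviation imp (infixr "\<rightarrow>" 60) where "x \<rightarrow> y \<equiv> oper M RImp [x, y]"
abbreviation bt where "bt \<equiv> oper M RZero []"
abbreviation tp where "tp \<equiv> oper M ROne []"

lemma lattice: "bounded_lattice_on R join meet bt tp"
  using rl by (simp add: residuated_lattice_def Let_def)

lemma imp_closed [simp]: "x \<in> R \<Longrightarrow> y \<in> R \<Longrightarrow> x \<rightarrow> y \<in> R"
  using rl by (simp add: residuated_lattice_def Let_def)

lemma residuation:
  "x \<in> R \<Longrightarrow> y \<in> R \<Longrightarrow> z \<in> R \<Longrightarrow> x \<squnion> (y \<rightarrow> z) = y \<rightarrow> z \<longleftrightarrow> x \<odot> y \<squnion> z = z"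
  using rl by (simp add: residuated_lattice_def Let_def)

lemma meet_closed [simp]: "x \<in> R \<Longrightarrow> y \<in> R \<Longrightarrow> x \<sqinter> y \<in> R"
  and bt_closed [simp]: "bt \<in> R"
  and bt_join [simp]: "x \<in> R \<Longrightarrow> bt \<squnion> x = x"
  using lattice unfolding bounded_lattice_on_def by blast+

sublocale lattice_monoid R join mult tp
proof
  note lat = lattice[unfolded bounded_lattice_on_def]
  have mult: "\<And>x y. x \<in> R \<Longrightarrow> y \<in> R \<Longrightarrow> x \<odot> y \<in> R \<and> x \<odot> y = y \<odot> x"
    using rl by (simp add: residuated_lattice_def Let_def)
  have join: "\<And>x y. x \<in> R \<Longrightarrow> y \<in> R \<Longrightarrow> x \<squnion> y \<in> R \<and> x \<squnion> y = y \<squnion> x"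
    "\<And>x y z. x \<in> R \<Longrightarrow> y \<in> R \<Longrightarrow> z \<in> R \<Longrightarrow> x \<squnion> y \<squnion> z = x \<squnion> (y \<squnion> z)"
    using lat by blast+
  have idem: "x \<squnion> x = x" if "x \<in> R" for x
    using bounded_lattice_on_idem[OF lattice that] by simp
  \<comment> \<open>Multiplication by \<open>x\<close> has the upper adjoint
    \<open>x \<rightarrow> _\<close>, and so preserves joins. The order \<open>\<sqsubseteq>\<close>
    becomes available only through this interpretation, so inequalities are spelled out as equations
    between joins.\<close>
  show "x \<odot> (y \<squnion> z) = x \<odot> y \<squnion> x \<odot> z" if x: "x \<in> R" "y \<in> R" "z \<in> R" for x y z
  proof -
    let ?w = "x \<odot> y \<squnion> x \<odot> z"
    have c: "?w \<in> R" "x \<odot> y \<in> R" "x \<odot> z \<in> R" "y \<squnion> z \<in> R" "x \<odot> (y \<squnion> z) \<in> R"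
      using x mult join by auto
    have "x \<odot> y \<squnion> ?w = ?w" "x \<odot> z \<squnion> ?w = ?w"
      using c idem join by metis+
    then have "y \<squnion> (x \<rightarrow> ?w) = x \<rightarrow> ?w" "z \<squnion> (x \<rightarrow> ?w) = x \<rightarrow> ?w"
      using x c mult residuation by metis+
    then have "(y \<squnion> z) \<squnion> (x \<rightarrow> ?w) = x \<rightarrow> ?w"
      using join(2)[of y z "x \<rightarrow> ?w"] x c by simp
    then have le: "x \<odot> (y \<squnion> z) \<squnion> ?w = ?w"
      using residuation[of "y \<squnion> z" x ?w] mult x c by metis
    have mono: "x \<odot> u \<squnion> x \<odot> v = x \<odot> v" if "u \<in> R" "v \<in> R" "u \<squnion> v = v" for u v
    proof -
      have "v \<squnion> (x \<rightarrow> x \<odot> v) = x \<rightarrow> x \<odot> v"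
        using residuation[of v x "x \<odot> v"] that x mult idem by metis
      then have "u \<squnion> (x \<rightarrow> x \<odot> v) = x \<rightarrow> x \<odot> v"
        using that x mult join(2)[of u v "x \<rightarrow> x \<odot> v"] by (metis imp_closed)
      then show ?thesis
        using residuation[of u x "x \<odot> v"] that x mult by metis
    qed
    have "y \<squnion> (y \<squnion> z) = y \<squnion> z" "z \<squnion> (y \<squnion> z) = y \<squnion> z"
      using x idem join by metis+
    then have "x \<odot> y \<squnion> x \<odot> (y \<squnion> z) = x \<odot> (y \<squnion> z)" "x \<odot> z \<squnion> x \<odot> (y \<squnion> z) = x \<odot> (y \<squnion> z)"
      using mono x c by blast+
    then have "?w \<squnion> x \<odot> (y \<squnion> z) = x \<odot> (y \<squnion> z)"
      using join(2)[of "x \<odot> y" "x \<odot> z" "x \<odot> (y \<squnion> z)"] c by simp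
    then show ?thesis
      using le c join by metis
  qed
  show "x \<odot> y \<odot> z = x \<odot> (y \<odot> z)" if "x \<in> R" "y \<in> R" "z \<in> R" for x y z
    using that rl unfolding residuated_lattice_def Let_def by blast
  show "x \<odot> tp = x" if "x \<in> R" for x
    using that rl by (simp add: residuated_lattice_def Let_def)
  show "x \<squnion> tp = tp" if "x \<in> R" for x
    using that bounded_lattice_on_tp[OF lattice] by blast
qed (use lattice bounded_lattice_on_idem[OF lattice] rl in
    \<open>auto simp: bounded_lattice_on_def residuated_lattice_def Let_def\<close>)

notation le (infix "\<sqsubseteq>" 50)

lemma le_imp_iff: "x \<in> R \<Longrightarrow> y \<in> R \<Longrightarrow> z \<in> R \<Longrightarrow> x \<sqsubseteq> y \<rightarrow> z \<longleftrightarrow> x \<odot> y \<sqsubseteq> z"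
  by (simp add: le_def residuation)

lemma imp_mult_le: "x \<in> R \<Longrightarrow> y \<in> R \<Longrightarrow> (x \<rightarrow> y) \<odot> x \<sqsubseteq> y"
  using le_imp_iff[of "x \<rightarrow> y" x y] by simp

lemma imp_self [simp]: "x \<in> R \<Longrightarrow> x \<rightarrow> x = tp"
  by (metis imp_closed le_antisym le_imp_iff le_tp mult_le2 tp_closed)

lemma tp_imp [simp]: "x \<in> R \<Longrightarrow> tp \<rightarrow> x = x"
  using imp_mult_le[of tp x] le_imp_iff[of x tp x] by (simp add: le_antisym)

lemma imp_tp [simp]: "x \<in> R \<Longrightarrow> x \<rightarrow> tp = tp"
  by (metis imp_closed le_antisym le_imp_iff le_tp mult_closed tp_closed)

lemma meet_le1: "x \<in> R \<Longrightarrow> y \<in> R \<Longrightarrow> x \<sqinter> y \<sqsubseteq> x"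
  and meet_le2: "x \<in> R \<Longrightarrow> y \<in> R \<Longrightarrow> x \<sqinter> y \<sqsubseteq> y"
  using lattice unfolding bounded_lattice_on_def le_def by metis+

lemma meet_greatest:
  "x \<in> R \<Longrightarrow> y \<in> R \<Longrightarrow> z \<in> R \<Longrightarrow> z \<sqsubseteq> x \<Longrightarrow> z \<sqsubseteq> y \<Longrightarrow> z \<sqsubseteq> x \<sqinter> y"
  using lattice unfolding bounded_lattice_on_def le_def by metis

lemma alg: "is_alg rl_ar M"
  unfolding is_alg_def
proof (intro conjI allI impI)
  show "carrier M \<noteq> {}"
    using tp_closed by blast
  show "oper M g xs \<in> R" if "length xs = rl_ar g \<and> set xs \<subseteq> R" for g xs
    using that by (cases g) (auto simp: length_2_iff)
qed

section \<open>Correspondence between congruences and filters of a residuated lattice\<close>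

definition con_of :: "'a set \<Rightarrow> ('a \<times> 'a) set" where
  "con_of F = {(x, y) \<in> R \<times> R. x \<rightarrow> y \<in> F \<and> y \<rightarrow> x \<in> F}"

definition top_class :: "('a \<times> 'a) set \<Rightarrow> 'a set" where
  "top_class \<theta> = {x \<in> R. (x, tp) \<in> \<theta>}"

text \<open>One-sided estimates, one for each argument position up to commutativity, that make
  \<open>con_of F\<close> compatible with the operations. By residuation each reduces to
  \<open>(x \<rightarrow> x') \<odot> x \<sqsubseteq> x'\<close> and monotonicity.\<close>

lemma imp_compat:
  assumes "x \<in> R" "x' \<in> R" "y \<in> R"
  shows "x \<rightarrow> x' \<sqsubseteq> (x \<squnion> y) \<rightarrow> (x' \<squnion> y)" "x \<rightarrow> x' \<sqsubseteq> (x \<sqinter> y) \<rightarrow> (x' \<sqinter> y)"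
    "x \<rightarrow> x' \<sqsubseteq> (x \<odot> y) \<rightarrow> (x' \<odot> y)" "x \<rightarrow> x' \<sqsubseteq> (x' \<rightarrow> y) \<rightarrow> (x \<rightarrow> y)"
    "x \<rightarrow> x' \<sqsubseteq> (y \<rightarrow> x) \<rightarrow> (y \<rightarrow> x')"
proof -
  let ?i = "x \<rightarrow> x'"
  have i: "?i \<in> R" "?i \<odot> x \<sqsubseteq> x'"
    using assms imp_mult_le by auto
  have "?i \<odot> (x \<squnion> y) \<sqsubseteq> x' \<squnion> y"
    using assms i by (simp add: mult_join join_mono)
  then show "?i \<sqsubseteq> (x \<squnion> y) \<rightarrow> (x' \<squnion> y)"
    using assms i by (simp add: le_imp_iff)
  have "?i \<odot> (x \<sqinter> y) \<sqsubseteq> ?i \<odot> x" "?i \<odot> (x \<sqinter> y) \<sqsubseteq> ?i \<odot> y"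
    using assms i meet_le1 meet_le2 by (auto intro!: mult_mono1)
  then have "?i \<odot> (x \<sqinter> y) \<sqsubseteq> x' \<sqinter> y"
    using assms i le_trans[of "?i \<odot> (x \<sqinter> y)" "?i \<odot> x" x'] le_trans[of "?i \<odot> (x \<sqinter> y)" "?i \<odot> y" y]
    by (simp add: meet_greatest)
  then show "?i \<sqsubseteq> (x \<sqinter> y) \<rightarrow> (x' \<sqinter> y)"
    using assms i by (simp add: le_imp_iff)
  have "?i \<odot> (x \<odot> y) \<sqsubseteq> x' \<odot> y"
    using assms i by (simp add: mult_assoc[symmetric] mult_mono)
  then show "?i \<sqsubseteq> (x \<odot> y) \<rightarrow> (x' \<odot> y)"
    using assms i by (simp add: le_imp_iff)
  have "?i \<odot> (x' \<rightarrow> y) \<odot> x = (x' \<rightarrow> y) \<odot> (?i \<odot> x)"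
    using assms i mult_comm[of ?i "x' \<rightarrow> y"] by (simp add: mult_assoc)
  also have "\<dots> \<sqsubseteq> (x' \<rightarrow> y) \<odot> x'"
    using assms i by (simp add: mult_mono1)
  finally have "?i \<odot> (x' \<rightarrow> y) \<odot> x \<sqsubseteq> y"
    using assms i imp_mult_le[of x' y] le_trans[of "?i \<odot> (x' \<rightarrow> y) \<odot> x" "(x' \<rightarrow> y) \<odot> x'" y]
    by simp
  then show "?i \<sqsubseteq> (x' \<rightarrow> y) \<rightarrow> (x \<rightarrow> y)"
    using assms i by (simp add: le_imp_iff)
  have "?i \<odot> (y \<rightarrow> x) \<odot> y \<sqsubseteq> ?i \<odot> x"
    using assms i imp_mult_le[of y x] by (simp add: mult_assoc mult_mono1)
  then have "?i \<odot> (y \<rightarrow> x) \<odot> y \<sqsubseteq> x'"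
    using assms i le_trans[of "?i \<odot> (y \<rightarrow> x) \<odot> y" "?i \<odot> x" x'] by simp
  then show "?i \<sqsubseteq> (y \<rightarrow> x) \<rightarrow> (y \<rightarrow> x')"
    using assms i by (simp add: le_imp_iff)
qed

lemma imp_trans: "x \<in> R \<Longrightarrow> y \<in> R \<Longrightarrow> z \<in> R \<Longrightarrow> (x \<rightarrow> y) \<odot> (y \<rightarrow> z) \<sqsubseteq> x \<rightarrow> z"
  using imp_compat(4)[of x y z] by (simp add: le_imp_iff)

lemma con_of_Con:
  assumes F: "is_filter F"
  shows "con_of F \<in> Con rl_ar M"
proof (rule ConI)
  note Fd = is_filterD[OF F]
  show trans: "(x, z) \<in> con_of F"
    if "(x, y) \<in> con_of F" "(y, z) \<in> con_of F" for x y z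
  proof -
    have c: "x \<in> R" "y \<in> R" "z \<in> R"
      and "x \<rightarrow> y \<in> F" "y \<rightarrow> x \<in> F" "y \<rightarrow> z \<in> F" "z \<rightarrow> y \<in> F"
      using that by (auto simp: con_of_def)
    then show ?thesis
      using Fd(4)[OF Fd(3) _ imp_trans[of x y z]] Fd(4)[OF Fd(3) _ imp_trans[of z y x]]
      by (simp add: con_of_def)
  qed
  fix g xs ys
  assume l: "length xs = rl_ar g" "length ys = rl_ar g"
    and r: "list_all2 (\<lambda>x y. (x, y) \<in> con_of F) xs ys"
  show "(oper M g xs, oper M g ys) \<in> con_of F"
  proof (cases "rl_ar g = 2")
    case True
    then obtain x y x' y' where xs: "xs = [x, y]" "ys = [x', y']"
      using l by (auto simp: length_2_iff)
    have c: "x \<in> R" "y \<in> R" "x' \<in> R" "y' \<in> R"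
      and i: "x \<rightarrow> x' \<in> F" "x' \<rightarrow> x \<in> F" "y \<rightarrow> y' \<in> F" "y' \<rightarrow> y \<in> F"
      using r by (auto simp: xs con_of_def)
    have up: "(u, v) \<in> con_of F"
      if "a \<in> F" "b \<in> F" "a \<sqsubseteq> u \<rightarrow> v" "b \<sqsubseteq> v \<rightarrow> u" "u \<in> R" "v \<in> R" for u v a b
      using that Fd(4) by (simp add: con_of_def)
    note ups = up[OF i(1,2)] up[OF i(3,4)]
    \<comment> \<open>Arguments are replaced one at a time; commutativity lets the same estimate
      serve both positions.\<close>
    have "(x \<squnion> y, x' \<squnion> y) \<in> con_of F" "(y \<squnion> x', y' \<squnion> x') \<in> con_of F"
      using c by (simp_all add: ups imp_compat(1))
    then have join: "(x \<squnion> y, x' \<squnion> y') \<in> con_of F"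
      using c trans join_comm by metis
    have "(x \<sqinter> y, x' \<sqinter> y) \<in> con_of F" "(y \<sqinter> x', y' \<sqinter> x') \<in> con_of F"
      using c by (simp_all add: ups imp_compat(2))
    moreover have "y \<sqinter> x' = x' \<sqinter> y" "y' \<sqinter> x' = x' \<sqinter> y'"
      using lattice c unfolding bounded_lattice_on_def by blast+
    ultimately have meet: "(x \<sqinter> y, x' \<sqinter> y') \<in> con_of F"
      using trans by metis
    have "(x \<odot> y, x' \<odot> y) \<in> con_of F" "(y \<odot> x', y' \<odot> x') \<in> con_of F"
      using c by (simp_all add: ups imp_compat(3))
    then have mult: "(x \<odot> y, x' \<odot> y') \<in> con_of F"
      using c trans mult_comm by metis
    \<comment> \<open>Implication is antitone in its first argument, which is why the two hypotheses
      on \<open>x\<close> and \<open>x'\<close> enter in swapped order.\<close>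
    have "(x \<rightarrow> y, x' \<rightarrow> y) \<in> con_of F"
      using c by (simp add: up[OF i(2,1)] imp_compat(4))
    moreover have "(x' \<rightarrow> y, x' \<rightarrow> y') \<in> con_of F"
      using c by (simp add: ups imp_compat(5))
    ultimately have imp: "(x \<rightarrow> y, x' \<rightarrow> y') \<in> con_of F"
      using trans by metis
    show ?thesis
      using True join meet mult imp by (cases g) (simp_all add: xs)
  next
    case False
    then have "xs = []" "ys = []" "oper M g [] \<in> R"
      using l by (cases g; simp)+
    then show ?thesis
      using Fd(2) by (simp add: con_of_def)
  qed
qed (auto simp: con_of_def is_filterD(2)[OF F])

lemma top_class_con_of: "is_filter F \<Longrightarrow> top_class (con_of F) = F"
  using is_filterD(1,2)[of F] by (auto simp: top_class_def con_of_def)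

lemma Con_binary:
  assumes "\<theta> \<in> Con rl_ar M" "(x, x') \<in> \<theta>" "(y, y') \<in> \<theta>" "rl_ar g = 2"
  shows "(oper M g [x, y], oper M g [x', y']) \<in> \<theta>"
  using Con_oper[OF assms(1), of "[x, y]" g "[x', y']"] assms by simp

lemma is_filter_top_class:
  assumes \<theta>: "\<theta> \<in> Con rl_ar M"
  shows "is_filter (top_class \<theta>)"
proof (rule is_filterI)
  fix x y
  show "x \<odot> y \<in> top_class \<theta>" if "x \<in> top_class \<theta>" "y \<in> top_class \<theta>"
    using that Con_binary[OF \<theta>, of x tp y tp RMult] by (auto simp: top_class_def)
  show "y \<in> top_class \<theta>" if x: "x \<in> top_class \<theta>" and "y \<in> R" "x \<sqsubseteq> y"
    using Con_binary[OF \<theta>, of x tp y y RJoin] x that Con_refl[OF \<theta>] join_comm[of tp y]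
    by (auto simp: top_class_def le_def)
qed (use Con_refl[OF \<theta>] in \<open>auto simp: top_class_def\<close>)

text \<open>If \<open>x \<rightarrow> y\<close> is congruent to \<open>tp\<close>, then
  \<open>(x \<rightarrow> y) \<odot> x\<close> is congruent to \<open>x\<close>. It lies below
  \<open>y\<close>, so joining with \<open>y\<close> makes \<open>y\<close> congruent to
  \<open>x \<squnion> y\<close>. By symmetry \<open>x\<close> is congruent to the same join.\<close>

lemma con_of_top_class:
  assumes \<theta>: "\<theta> \<in> Con rl_ar M"
  shows "con_of (top_class \<theta>) = \<theta>"
proof -
  have fwd: "(x \<rightarrow> y, tp) \<in> \<theta>" if "(x, y) \<in> \<theta>" "x \<in> R" "y \<in> R" for x y
    using Con_binary[OF \<theta>, of x y y y RImp] that Con_refl[OF \<theta>] by simp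
  have bwd: "(x \<squnion> y, y) \<in> \<theta>" if "(x \<rightarrow> y, tp) \<in> \<theta>" "x \<in> R" "y \<in> R" for x y
  proof -
    have "((x \<rightarrow> y) \<odot> x, tp \<odot> x) \<in> \<theta>"
      using Con_binary[OF \<theta>, of "x \<rightarrow> y" tp x x RMult] that Con_refl[OF \<theta>] by simp
    then have "((x \<rightarrow> y) \<odot> x \<squnion> y, x \<squnion> y) \<in> \<theta>"
      using Con_binary[OF \<theta>, of "(x \<rightarrow> y) \<odot> x" x y y RJoin] that Con_refl[OF \<theta>] mult_comm[of tp x]
      by simp
    then show ?thesis
      using imp_mult_le[of x y] that Con_sym[OF \<theta>] by (simp add: le_def)
  qed
  have "(x, y) \<in> con_of (top_class \<theta>) \<longleftrightarrow> (x, y) \<in> \<theta>" for x y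
  proof
    assume "(x, y) \<in> \<theta>"
    then show "(x, y) \<in> con_of (top_class \<theta>)"
      using fwd Con_sym[OF \<theta>] Con_subset[OF \<theta>] by (auto simp: con_of_def top_class_def)
  next
    assume "(x, y) \<in> con_of (top_class \<theta>)"
    then have "(x \<squnion> y, y) \<in> \<theta>" "(y \<squnion> x, x) \<in> \<theta>" "x \<in> R" "y \<in> R"
      using bwd by (auto simp: con_of_def top_class_def)
    then show "(x, y) \<in> \<theta>"
      using join_comm[of x y] Con_sym[OF \<theta>] Con_trans[OF \<theta>] by metis
  qed
  then show ?thesis
    by auto
qed

lemma top_class_mono_iff:
  assumes "\<alpha> \<in> Con rl_ar M" "\<beta> \<in> Con rl_ar M"
  shows "top_class \<alpha> \<subseteq> top_class \<beta> \<longleftrightarrow> \<alpha> \<subseteq> \<beta>"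
proof
  assume "top_class \<alpha> \<subseteq> top_class \<beta>"
  then have "con_of (top_class \<alpha>) \<subseteq> con_of (top_class \<beta>)"
    by (auto simp: con_of_def)
  then show "\<alpha> \<subseteq> \<beta>"
    using assms by (simp add: con_of_top_class)
qed (auto simp: top_class_def)

lemma top_class_Nabla_iff:
  assumes "\<theta> \<in> Con rl_ar M"
  shows "top_class \<theta> = R \<longleftrightarrow> \<theta> = Nabla M"
proof
  assume "top_class \<theta> = R"
  moreover have "con_of R = Nabla M"
    by (auto simp: con_of_def)
  ultimately show "\<theta> = Nabla M"
    using con_of_top_class[OF assms] by simp
qed (auto simp: top_class_def)

text \<open>For a join \<open>x \<squnion> y\<close> in the top class \<open>P\<close>, primality of
  the congruence is tested on two filters: \<open>?G\<close> is the polar of \<open>x\<close>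
  relative to \<open>P\<close>, and \<open>?F\<close> the polar of \<open>?G\<close>, so that
  \<open>x\<close> is in \<open>?F\<close> and \<open>y\<close> in \<open>?G\<close>. Conversely, if
  neither \<open>\<alpha>\<close> nor \<open>\<beta>\<close> is below \<open>\<theta>\<close>, the
  join of a witness from each top class lies in both of them, which contradicts primality of the
  filter.\<close>

lemma Spec_iff: "\<theta> \<in> Spec rl_ar M \<longleftrightarrow> \<theta> \<in> Con rl_ar M \<and> prime_filter (top_class \<theta>)"
proof
  assume S: "\<theta> \<in> Spec rl_ar M"
  then have \<theta>: "\<theta> \<in> Con rl_ar M" "\<theta> \<noteq> Nabla M"
    by (auto simp: Spec_def)
  let ?P = "top_class \<theta>"
  have P: "is_filter ?P"
    using is_filter_top_class[OF \<theta>(1)] .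
  note Pd = is_filterD[OF P]
  have "x \<in> ?P \<or> y \<in> ?P" if xy: "x \<in> R" "y \<in> R" "x \<squnion> y \<in> ?P" for x y
  proof -
    \<comment> \<open>joins of elements of \<open>F\<close> and \<open>G\<close> are in \<open>P\<close>, hence \<open>F \<inter> G \<subseteq> P\<close> by idempotency\<close>
    let ?G = "{z \<in> R. z \<squnion> x \<in> ?P}"
    let ?F = "{z \<in> R. \<forall>w\<in>?G. z \<squnion> w \<in> ?P}"
    have G: "is_filter ?G"
      using is_filter_residual[OF P xy(1)] .
    have F: "is_filter ?F"
    proof -
      have res: "is_filter {z \<in> R. z \<squnion> w \<in> ?P}" if "w \<in> ?G" for w
        using is_filter_residual[OF P] that by blast
      show ?thesis
      proof (rule is_filterI)
        show "tp \<in> ?F"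
          using is_filterD(2)[OF res] tp_closed by blast
        show "a \<odot> b \<in> ?F" if "a \<in> ?F" "b \<in> ?F" for a b
          using is_filterD(3)[OF res, of _ a b] that mult_closed by blast
        show "b \<in> ?F" if "a \<in> ?F" "b \<in> R" "a \<sqsubseteq> b" for a b
          using is_filterD(4)[OF res, of _ a b] that by blast
      qed blast
    qed
    have "?F \<inter> ?G \<subseteq> ?P"
    proof
      fix z assume "z \<in> ?F \<inter> ?G"
      then have "z \<squnion> z \<in> ?P" "z \<in> R"
        by blast+
      then show "z \<in> ?P"
        by simp
    qed
    then have "con_of ?F \<inter> con_of ?G \<subseteq> con_of ?P"
      unfolding con_of_def by blast
    then have "con_of ?F \<inter> con_of ?G \<subseteq> \<theta>"
      by (simp only: con_of_top_class[OF \<theta>(1)])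
    then have "con_of ?F \<subseteq> \<theta> \<or> con_of ?G \<subseteq> \<theta>"
      using S con_of_Con[OF F] con_of_Con[OF G] unfolding Spec_def by blast
    then have "?F \<subseteq> ?P \<or> ?G \<subseteq> ?P"
      using top_class_mono_iff[OF con_of_Con[OF F] \<theta>(1)]
        top_class_mono_iff[OF con_of_Con[OF G] \<theta>(1)]
      by (simp only: top_class_con_of[OF F] top_class_con_of[OF G])
    moreover have "x \<in> ?F"
      using xy(1) join_comm by auto
    moreover have "y \<in> ?G"
      using xy join_comm[of x y] by auto
    ultimately show ?thesis
      by blast
  qed
  then show "\<theta> \<in> Con rl_ar M \<and> prime_filter ?P"
    using P \<theta> top_class_Nabla_iff[OF \<theta>(1)] by (simp add: prime_filter_def)
next
  assume "\<theta> \<in> Con rl_ar M \<and> prime_filter (top_class \<theta>)"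
  then have \<theta>: "\<theta> \<in> Con rl_ar M" and ne: "top_class \<theta> \<noteq> R"
    and prime: "\<And>x y. x \<in> R \<Longrightarrow> y \<in> R \<Longrightarrow> x \<squnion> y \<in> top_class \<theta> \<Longrightarrow>
      x \<in> top_class \<theta> \<or> y \<in> top_class \<theta>"
    by (auto simp: prime_filter_def)
  have "\<alpha> \<subseteq> \<theta> \<or> \<beta> \<subseteq> \<theta>"
    if \<alpha>: "\<alpha> \<in> Con rl_ar M" and \<beta>: "\<beta> \<in> Con rl_ar M" and "\<alpha> \<inter> \<beta> \<subseteq> \<theta>" for \<alpha> \<beta>
  proof (rule ccontr)
    assume "\<not> (\<alpha> \<subseteq> \<theta> \<or> \<beta> \<subseteq> \<theta>)"
    then have "\<not> top_class \<alpha> \<subseteq> top_class \<theta>" "\<not> top_class \<beta> \<subseteq> top_class \<theta>"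
      using \<alpha> \<beta> \<theta> by (simp_all add: top_class_mono_iff)
    then obtain x y where x: "x \<in> top_class \<alpha>" "x \<notin> top_class \<theta>"
      and y: "y \<in> top_class \<beta>" "y \<notin> top_class \<theta>"
      by blast
    note \<alpha>d = is_filterD[OF is_filter_top_class[OF \<alpha>]]
      and \<beta>d = is_filterD[OF is_filter_top_class[OF \<beta>]]
    have R: "x \<in> R" "y \<in> R"
      using x y by (auto simp: top_class_def)
    have "x \<squnion> y \<in> top_class \<alpha>" "x \<squnion> y \<in> top_class \<beta>"
      using \<alpha>d(4)[OF x(1)] \<beta>d(4)[OF y(1)] R by simp_all
    then have "x \<squnion> y \<in> top_class \<theta>"
      using \<open>\<alpha> \<inter> \<beta> \<subseteq> \<theta>\<close> by (auto simp: top_class_def)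
    then show False
      using prime R x(2) y(2) by blast
  qed
  then show "\<theta> \<in> Spec rl_ar M"
    using \<theta> ne top_class_Nabla_iff[OF \<theta>] by (simp add: Spec_def)
qed

end

section \<open>Morphisms of residuated lattices\<close>

locale resid_lattice_hom = A: resid_lattice A + B: resid_lattice B
  for A :: "(rl_sym, 'a) alg" and B :: "(rl_sym, 'b) alg" +
  fixes f assumes f: "f \<in> homs rl_ar A B"
begin

lemma f_closed: "x \<in> carrier A \<Longrightarrow> f x \<in> carrier B"
  using homsD(1)[OF f] .

lemma f_tp: "f A.tp = B.tp" and f_bt: "f A.bt = B.bt"
  using homsD(2)[OF f, of "[]"] by simp_all

lemma f_binary:
  "rl_ar g = 2 \<Longrightarrow> x \<in> carrier A \<Longrightarrow> y \<in> carrier A \<Longrightarrow> f (oper A g [x, y]) = oper B g [f x, f y]"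
  using homsD(2)[OF f, of "[x, y]" g] by simp

lemma top_class_pullback:
  "A.top_class (pullback A f \<psi>) = {x \<in> carrier A. f x \<in> B.top_class \<psi>}"
  by (auto simp: A.top_class_def B.top_class_def pullback_def f_tp f_closed)

text \<open>Preimages of prime filters stay proper because a proper filter omits the bottom, which
  \<open>f\<close> preserves.\<close>

lemma admissible: "admissible rl_ar A B f"
  unfolding admissible_def
proof
  fix \<psi> assume "\<psi> \<in> Spec rl_ar B"
  then have \<psi>: "\<psi> \<in> Con rl_ar B" and P: "B.prime_filter (B.top_class \<psi>)"
    by (auto simp: B.Spec_iff)
  have pb: "pullback A f \<psi> \<in> Con rl_ar A"
    using pullback_Con[OF A.alg f \<psi>] .
  let ?Q = "{x \<in> carrier A. f x \<in> B.top_class \<psi>}"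
  have "B.bt \<notin> B.top_class \<psi>"
  proof
    assume bt: "B.bt \<in> B.top_class \<psi>"
    have "B.le B.bt x" if "x \<in> carrier B" for x
      using that by (simp add: B.le_def)
    then have "carrier B \<subseteq> B.top_class \<psi>"
      using P bt B.is_filterD(4) unfolding B.prime_filter_def by blast
    then show False
      using P by (auto simp: B.prime_filter_def B.top_class_def)
  qed
  then have "A.bt \<notin> ?Q"
    by (simp add: f_bt)
  then have "?Q \<noteq> carrier A"
    using A.bt_closed by blast
  then have "A.prime_filter ?Q"
    using P A.is_filter_top_class[OF pb] f_closed
    unfolding A.prime_filter_def B.prime_filter_def top_class_pullback by (auto simp: f_binary)
  then show "pullback A f \<psi> \<in> Spec rl_ar A"
    using pb by (simp add: A.Spec_iff top_class_pullback)
qed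

text \<open>Stated for an arbitrary congruence \<open>\<beta>\<close> of \<open>B\<close>, so that a
  prime one gives GU and equality gives LO.\<close>

lemma extend_prime:
  assumes \<psi>: "\<psi> \<in> Spec rl_ar A" and \<beta>: "\<beta> \<in> Con rl_ar B" and sub: "pullback A f \<beta> \<subseteq> \<psi>"
  shows "\<exists>\<psi>1\<in>Spec rl_ar B. \<beta> \<subseteq> \<psi>1 \<and> pullback A f \<psi>1 = \<psi>"
proof -
  let ?P1 = "B.top_class \<beta>" and ?Q = "A.top_class \<psi>"
  have \<psi>C: "\<psi> \<in> Con rl_ar A" and Q: "A.prime_filter ?Q"
    using \<psi> by (auto simp: A.Spec_iff)
  have P1: "B.is_filter ?P1"
    using B.is_filter_top_class[OF \<beta>] .
  have fQ: "A.is_filter ?Q"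
    using Q by (simp add: A.prime_filter_def)
  \<comment> \<open>Residuation moves \<open>f q\<close> to the other side: \<open>p\<close> lies
    below the image of \<open>A.imp q a\<close>, so this implication belongs to \<open>?Q\<close>,
    and multiplying by \<open>q\<close> yields an element of \<open>?Q\<close> below
    \<open>a\<close>.\<close>
  have sep: "a \<in> ?Q"
    if p: "p \<in> ?P1" and q: "q \<in> ?Q" and a: "a \<in> carrier A"
      and le: "B.le (B.mult p (f q)) (f a)" for p q a
  proof -
    have R: "p \<in> carrier B" "q \<in> carrier A"
      using p q by (auto simp: A.top_class_def B.top_class_def)
    then have "B.le p (f (A.imp q a))"
      using le a f_closed by (simp add: f_binary B.le_imp_iff)
    then have "f (A.imp q a) \<in> ?P1"
      using B.is_filterD(4)[OF P1 p] R a f_closed by simp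
    then have "A.imp q a \<in> A.top_class (pullback A f \<beta>)"
      using R a by (simp add: top_class_pullback)
    then have "A.imp q a \<in> ?Q"
      using sub by (auto simp: A.top_class_def)
    then have "A.mult (A.imp q a) q \<in> ?Q"
      using A.is_filterD(3)[OF fQ] q by blast
    then show ?thesis
      using A.is_filterD(4)[OF fQ _ a] A.imp_mult_le R a by blast
  qed
  obtain Q1 where Q1: "B.prime_filter Q1" "?P1 \<subseteq> Q1" "{x \<in> carrier A. f x \<in> Q1} = ?Q"
    by (rule prime_filter_lying_over[where f = f, OF A.lattice_monoid_axioms B.lattice_monoid_axioms
          f_closed _ _ f_tp Q P1 sep]) (auto simp: f_binary)
  have fQ1: "B.is_filter Q1"
    using Q1(1) by (simp add: B.prime_filter_def)
  let ?\<psi>1 = "B.con_of Q1"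
  have C: "?\<psi>1 \<in> Con rl_ar B"
    using B.con_of_Con[OF fQ1] .
  have "?\<psi>1 \<in> Spec rl_ar B"
    using C Q1(1) by (simp add: B.Spec_iff B.top_class_con_of[OF fQ1])
  moreover have "\<beta> \<subseteq> ?\<psi>1"
    using B.top_class_mono_iff[OF \<beta> C] Q1(2) by (simp add: B.top_class_con_of[OF fQ1])
  moreover have "A.top_class (pullback A f ?\<psi>1) = ?Q"
    using Q1(3) by (simp add: top_class_pullback B.top_class_con_of[OF fQ1])
  then have "pullback A f ?\<psi>1 = \<psi>"
    using A.con_of_top_class pullback_Con[OF A.alg f C] \<psi>C by metis
  ultimately show ?thesis
    by blast
qed

lemma GU: "fulfills_GU rl_ar A B f"
  unfolding fulfills_GU_def using extend_prime by (auto simp: B.Spec_iff)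

lemma LO: "fulfills_LO rl_ar A B f"
  unfolding fulfills_LO_def Ker_def using extend_prime[OF _ Delta_Con[OF B.alg]] by blast

end

section \<open>Bounded distributive lattices\<close>

locale dist_lattice =
  fixes M :: "(bl_sym, 'a) alg"
  assumes bdl: "bounded_distributive_lattice M"
begin

abbreviation "R \<equiv> carrier M"
abbreviation join (infixl "\<squnion>" 65) where "x \<squnion> y \<equiv> oper M LJoin [x, y]"
abbreviation meet (infixl "\<sqinter>" 70) where "x \<sqinter> y \<equiv> oper M LMeet [x, y]"
abbreviation bt where "bt \<equiv> oper M LZero []"
abbreviation tp where "tp \<equiv> oper M LOne []"

lemma lattice: "bounded_lattice_on R join meet bt tp"
  using bdl by (simp add: bounded_distributive_lattice_def Let_def)

sublocale lattice_monoid R join meet tp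
proof
  note lat = lattice[unfolded bounded_lattice_on_def]
  show "x \<sqinter> (y \<squnion> z) = x \<sqinter> y \<squnion> x \<sqinter> z" if "x \<in> R" "y \<in> R" "z \<in> R" for x y z
    using that bdl by (simp add: bounded_distributive_lattice_def Let_def)
  show "x \<sqinter> tp = x" "x \<squnion> tp = tp" if "x \<in> R" for x
    using that lat bounded_lattice_on_tp[OF lattice that] by metis+
qed (use lattice bounded_lattice_on_idem[OF lattice] in \<open>auto simp: bounded_lattice_on_def\<close>)

notation le (infix "\<sqsubseteq>" 50)

lemma bt_closed [simp]: "bt \<in> R"
  and bt_join [simp]: "x \<in> R \<Longrightarrow> bt \<squnion> x = x" and bt_meet [simp]: "x \<in> R \<Longrightarrow> bt \<sqinter> x = bt"
  and meet_idem [simp]: "x \<in> R \<Longrightarrow> x \<sqinter> x = x" and tp_meet [simp]: "x \<in> R \<Longrightarrow> tp \<sqinter> x = x"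
  and tp_join [simp]: "x \<in> R \<Longrightarrow> tp \<squnion> x = tp"
  and absorb: "x \<in> R \<Longrightarrow> y \<in> R \<Longrightarrow> x \<squnion> x \<sqinter> y = x"
  and absorb': "x \<in> R \<Longrightarrow> y \<in> R \<Longrightarrow> x \<sqinter> (x \<squnion> y) = x"
proof -
  note lat = lattice[unfolded bounded_lattice_on_def]
  show "bt \<in> R" using lat by blast
  show "bt \<squnion> x = x" "bt \<sqinter> x = bt" "tp \<sqinter> x = x" "tp \<squnion> x = tp"
    if "x \<in> R" using lat that bounded_lattice_on_tp[OF lattice that] by metis+
  show "x \<sqinter> x = x" if "x \<in> R" using bounded_lattice_on_idem[OF lattice that] by blast
  show "x \<squnion> x \<sqinter> y = x" "x \<sqinter> (x \<squnion> y) = x" if "x \<in> R" "y \<in> R" using lat that by blast+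
qed

lemma alg: "is_alg bl_ar M"
  unfolding is_alg_def
proof (intro conjI allI impI)
  show "carrier M \<noteq> {}"
    using tp_closed by blast
  show "oper M g xs \<in> R" if "length xs = bl_ar g \<and> set xs \<subseteq> R" for g xs
    using that by (cases g) (auto simp: length_2_iff)
qed

lemma Con_binary:
  assumes "\<theta> \<in> Con bl_ar M" "(x, x') \<in> \<theta>" "(y, y') \<in> \<theta>" "bl_ar g = 2"
  shows "(oper M g [x, y], oper M g [x', y']) \<in> \<theta>"
  using Con_oper[OF assms(1), of "[x, y]" g "[x', y']"] assms by simp

text \<open>The dual distributive law; it makes joining with \<open>a\<close> preserve
  meets.\<close>

lemma join_distrib:
  assumes "a \<in> R" "x \<in> R" "y \<in> R"
  shows "(x \<squnion> a) \<sqinter> (y \<squnion> a) = x \<sqinter> y \<squnion> a"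
proof -
  have "(x \<squnion> a) \<sqinter> (y \<squnion> a) = (x \<squnion> a) \<sqinter> y \<squnion> (x \<squnion> a) \<sqinter> a"
    using assms by (simp add: mult_join)
  also have "(x \<squnion> a) \<sqinter> a = a"
    using assms by (metis absorb' join_closed join_comm mult_comm)
  also have "(x \<squnion> a) \<sqinter> y = x \<sqinter> y \<squnion> a \<sqinter> y"
    using assms by (simp add: mult_comm[of _ y] mult_join)
  also have "x \<sqinter> y \<squnion> a \<sqinter> y \<squnion> a = x \<sqinter> y \<squnion> a"
    using assms by (metis absorb join_assoc join_comm mult_closed)
  finally show ?thesis .
qed

text \<open>Intended for \<open>h\<close> meeting or joining with a fixed element, which may move a
  bound. Nullary operations ask only for reflexivity, so preserving joins and meets is
  enough.\<close>

lemma equalizer_Con: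
  assumes h: "\<And>x. x \<in> R \<Longrightarrow> h x \<in> R"
    "\<And>x y. x \<in> R \<Longrightarrow> y \<in> R \<Longrightarrow> h (x \<squnion> y) = h x \<squnion> h y"
    "\<And>x y. x \<in> R \<Longrightarrow> y \<in> R \<Longrightarrow> h (x \<sqinter> y) = h x \<sqinter> h y"
  shows "{(x, y) \<in> R \<times> R. h x = h y} \<in> Con bl_ar M"
proof (rule ConI)
  fix g xs ys
  assume l: "length xs = bl_ar g" "length ys = bl_ar g"
    and r: "list_all2 (\<lambda>x y. (x, y) \<in> {(x, y) \<in> R \<times> R. h x = h y}) xs ys"
  show "(oper M g xs, oper M g ys) \<in> {(x, y) \<in> R \<times> R. h x = h y}"
    using l r by (cases g) (auto simp: length_2_iff h)
qed auto

text \<open>A congruence not below \<open>\<phi>\<close> identifies some element of the class of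
  \<open>bt\<close> with one of the class of \<open>tp\<close>. Two such crossing pairs, one for
  each congruence, combine into a single crossing pair that lies in both.\<close>

lemma two_class_Spec:
  assumes \<phi>: "\<phi> \<in> Con bl_ar M" and ne: "(bt, tp) \<notin> \<phi>"
    and two: "\<And>x. x \<in> R \<Longrightarrow> (x, bt) \<in> \<phi> \<or> (x, tp) \<in> \<phi>"
  shows "\<phi> \<in> Spec bl_ar M"
proof -
  note \<phi>d = Con_refl[OF \<phi>] Con_sym[OF \<phi>] Con_trans[OF \<phi>]
  have pair: "\<exists>x y. (x, y) \<in> \<alpha> \<and> (x, bt) \<in> \<phi> \<and> (y, tp) \<in> \<phi>"
    if \<alpha>: "\<alpha> \<in> Con bl_ar M" "\<not> \<alpha> \<subseteq> \<phi>" for \<alpha>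
  proof -
    obtain x y where xy: "(x, y) \<in> \<alpha>" "(x, y) \<notin> \<phi>"
      using \<alpha>(2) by auto
    then have R: "x \<in> R" "y \<in> R"
      using Con_subset[OF \<alpha>(1)] by auto
    show ?thesis
      using xy two[OF R(1)] two[OF R(2)] \<phi>d(2,3) Con_sym[OF \<alpha>(1)] by meson
  qed
  have "\<alpha> \<subseteq> \<phi> \<or> \<beta> \<subseteq> \<phi>"
    if \<alpha>: "\<alpha> \<in> Con bl_ar M" and \<beta>: "\<beta> \<in> Con bl_ar M" and sub: "\<alpha> \<inter> \<beta> \<subseteq> \<phi>" for \<alpha> \<beta>
  proof (rule ccontr)
    assume "\<not> (\<alpha> \<subseteq> \<phi> \<or> \<beta> \<subseteq> \<phi>)"
    then obtain x y z w where xy: "(x, y) \<in> \<alpha>" "(x, bt) \<in> \<phi>" "(y, tp) \<in> \<phi>"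
      and zw: "(z, w) \<in> \<beta>" "(z, bt) \<in> \<phi>" "(w, tp) \<in> \<phi>"
      using pair[OF \<alpha>] pair[OF \<beta>] by meson
    have R: "x \<in> R" "y \<in> R" "z \<in> R" "w \<in> R"
      using xy(1) zw(1) Con_subset[OF \<alpha>] Con_subset[OF \<beta>] by auto
    \<comment> \<open>The pair \<open>p, q\<close> is in both congruences, as \<open>p\<close> becomes \<open>q\<close> by absorption when \<open>x\<close> is
      replaced by \<open>y\<close> or \<open>z\<close> by \<open>w\<close>; modulo \<open>\<phi>\<close> it is \<open>bt, tp\<close>.\<close>
    let ?q = "y \<sqinter> w" and ?p = "x \<sqinter> (y \<sqinter> w) \<squnion> z \<sqinter> (y \<sqinter> w)"
    have q: "?q \<in> R" "y \<sqinter> ?q = ?q" "w \<sqinter> ?q = ?q"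
      using R by (auto simp: mult_assoc[symmetric]) (metis meet_idem mult_assoc mult_comm)
    have "(x \<sqinter> ?q, y \<sqinter> ?q) \<in> \<alpha>"
      using Con_binary[OF \<alpha> xy(1), of ?q ?q LMeet] Con_refl[OF \<alpha> q(1)] by simp
    then have "(?p, ?q \<squnion> z \<sqinter> ?q) \<in> \<alpha>"
      using Con_binary[OF \<alpha>, of "x \<sqinter> ?q" ?q "z \<sqinter> ?q" "z \<sqinter> ?q" LJoin] Con_refl[OF \<alpha>] R q by simp
    moreover have "?q \<squnion> z \<sqinter> ?q = ?q" "x \<sqinter> ?q \<squnion> ?q = ?q"
      using absorb[OF q(1)] R q(1) by (metis mult_comm, metis join_comm mult_closed mult_comm)
    moreover have "(z \<sqinter> ?q, w \<sqinter> ?q) \<in> \<beta>"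
      using Con_binary[OF \<beta> zw(1), of ?q ?q LMeet] Con_refl[OF \<beta> q(1)] by simp
    then have "(?p, x \<sqinter> ?q \<squnion> ?q) \<in> \<beta>"
      using Con_binary[OF \<beta>, of "x \<sqinter> ?q" "x \<sqinter> ?q" "z \<sqinter> ?q" ?q LJoin] Con_refl[OF \<beta>] R q by simp
    ultimately have "(?p, ?q) \<in> \<phi>"
      using sub by auto
    moreover have "(?q, tp \<sqinter> tp) \<in> \<phi>"
      using Con_binary[OF \<phi> xy(3) zw(3), of LMeet] by simp
    moreover have "(x \<sqinter> ?q, bt \<sqinter> ?q) \<in> \<phi>" "(z \<sqinter> ?q, bt \<sqinter> ?q) \<in> \<phi>"
      using Con_binary[OF \<phi> xy(2), of ?q ?q LMeet] Con_binary[OF \<phi> zw(2), of ?q ?q LMeet]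
        Con_refl[OF \<phi> q(1)] by simp_all
    then have "(?p, bt) \<in> \<phi>"
      using Con_binary[OF \<phi>, of "x \<sqinter> ?q" bt "z \<sqinter> ?q" bt LJoin] q(1) by simp
    ultimately show False
      using ne \<phi>d(2,3) by (metis mult_tp tp_closed)
  qed
  moreover have "\<phi> \<noteq> Nabla M"
    using ne by auto
  ultimately show ?thesis
    using \<phi> by (simp add: Spec_def)
qed

lemma Spec_two_class:
  assumes \<phi>: "\<phi> \<in> Spec bl_ar M"
  shows "(bt, tp) \<notin> \<phi>" and "a \<in> R \<Longrightarrow> (a, bt) \<in> \<phi> \<or> (a, tp) \<in> \<phi>"
proof -
  have C: "\<phi> \<in> Con bl_ar M" "\<phi> \<noteq> Nabla M"
    using \<phi> by (auto simp: Spec_def)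
  show "(bt, tp) \<notin> \<phi>"
  proof
    assume *: "(bt, tp) \<in> \<phi>"
    have "(bt, x) \<in> \<phi>" if "x \<in> R" for x
      using Con_binary[OF C(1) *, of x x LMeet] Con_refl[OF C(1)] that by simp
    then have "(x, y) \<in> \<phi>" if "x \<in> R" "y \<in> R" for x y
      using that Con_trans[OF C(1) Con_sym[OF C(1)]] by blast
    then have "Nabla M \<subseteq> \<phi>"
      by auto
    then show False
      using C Con_subset[OF C(1)] by blast
  qed
  show "(a, bt) \<in> \<phi> \<or> (a, tp) \<in> \<phi>" if a: "a \<in> R"
  proof -
    \<comment> \<open>these congruences contain \<open>(a, tp)\<close> and \<open>(a, bt)\<close>, and by distributivity they meet in equality\<close>
    let ?\<alpha> = "{(x, y) \<in> R \<times> R. x \<sqinter> a = y \<sqinter> a}" and ?\<beta> = "{(x, y) \<in> R \<times> R. x \<squnion> a = y \<squnion> a}"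
    have "?\<alpha> \<in> Con bl_ar M"
    proof (rule equalizer_Con)
      fix x y assume xy: "x \<in> R" "y \<in> R"
      then show "(x \<squnion> y) \<sqinter> a = x \<sqinter> a \<squnion> y \<sqinter> a"
        using a by (simp add: mult_comm[of _ a] mult_join)
      show "x \<sqinter> y \<sqinter> a = x \<sqinter> a \<sqinter> (y \<sqinter> a)"
        using a xy by (smt (verit) meet_idem mult_assoc mult_closed mult_comm)
    qed (use a in simp)
    moreover have "?\<beta> \<in> Con bl_ar M"
    proof (rule equalizer_Con)
      fix x y assume xy: "x \<in> R" "y \<in> R"
      show "x \<squnion> y \<squnion> a = x \<squnion> a \<squnion> (y \<squnion> a)"
        using a xy by (smt (verit) join_idem join_assoc join_closed join_comm)
      show "x \<sqinter> y \<squnion> a = (x \<squnion> a) \<sqinter> (y \<squnion> a)"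
        using a xy by (simp add: join_distrib)
    qed (use a in simp)
    moreover have "?\<alpha> \<inter> ?\<beta> \<subseteq> \<phi>"
    proof clarify
      fix x y assume xy: "x \<in> R" "y \<in> R" "x \<sqinter> a = y \<sqinter> a" "x \<squnion> a = y \<squnion> a"
      have "x = x \<sqinter> (y \<squnion> a)"
        using xy a absorb' by metis
      also have "\<dots> = y \<sqinter> x \<squnion> y \<sqinter> a"
        using xy a by (simp add: mult_join mult_comm[of x y])
      also have "\<dots> = y \<sqinter> (x \<squnion> a)"
        using xy(1,2) a by (simp add: mult_join)
      also have "\<dots> = y"
        using xy a absorb' by metis
      finally show "(x, y) \<in> \<phi>"
        using Con_refl[OF C(1)] xy by simp
    qed
    ultimately have "?\<alpha> \<subseteq> \<phi> \<or> ?\<beta> \<subseteq> \<phi>"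
      using \<phi> unfolding Spec_def by blast
    moreover have "(a, tp) \<in> ?\<alpha>" "(a, bt) \<in> ?\<beta>"
      using a by auto
    ultimately show ?thesis
      by blast
  qed
qed

lemma Spec_le_eq:
  assumes \<phi>: "\<phi> \<in> Spec bl_ar M" and \<psi>: "\<psi> \<in> Spec bl_ar M" and sub: "\<phi> \<subseteq> \<psi>"
  shows "\<phi> = \<psi>"
proof -
  have C: "\<phi> \<in> Con bl_ar M" "\<psi> \<in> Con bl_ar M"
    using \<phi> \<psi> by (auto simp: Spec_def)
  have "(x, y) \<in> \<phi>" if xy: "(x, y) \<in> \<psi>" for x y
  proof -
    have R: "x \<in> R" "y \<in> R"
      using xy Con_subset[OF C(2)] by auto
    show ?thesis
      using Spec_two_class(2)[OF \<phi> R(1)] Spec_two_class(2)[OF \<phi> R(2)] Spec_two_class(1)[OF \<psi>]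
        xy sub Con_sym[OF C(1)] Con_trans[OF C(1)] Con_sym[OF C(2)] Con_trans[OF C(2)]
      by (meson subsetD)
  qed
  then show ?thesis
    using sub by auto
qed

lemma prime_filter_bt:
  assumes "prime_filter P"
  shows "bt \<notin> P"
proof
  assume "bt \<in> P"
  moreover have "bt \<sqsubseteq> x" if "x \<in> R" for x
    using that by (simp add: le_def)
  ultimately have "R \<subseteq> P"
    using assms is_filterD(4) unfolding prime_filter_def by blast
  then show False
    using assms is_filterD(1) by (auto simp: prime_filter_def)
qed

lemma prime_filter_Spec:
  assumes P: "prime_filter P"
  shows "{(x, y) \<in> R \<times> R. x \<in> P \<longleftrightarrow> y \<in> P} \<in> Spec bl_ar M"
proof -
  have fil: "is_filter P"
    using P by (simp add: prime_filter_def)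
  note Pd = is_filterD[OF fil]
  have join: "x \<squnion> y \<in> P \<longleftrightarrow> x \<in> P \<or> y \<in> P" if "x \<in> R" "y \<in> R" for x y
    using P that Pd(4) le_join1 le_join2 join_closed unfolding prime_filter_def by metis
  have meet: "x \<sqinter> y \<in> P \<longleftrightarrow> x \<in> P \<and> y \<in> P" if "x \<in> R" "y \<in> R" for x y
    using that Pd(3,4) mult_le1 mult_le2 mult_closed by metis
  show ?thesis
  proof (rule two_class_Spec)
    show "{(x, y) \<in> R \<times> R. x \<in> P \<longleftrightarrow> y \<in> P} \<in> Con bl_ar M"
    proof (rule ConI)
      fix g xs ys
      assume "length xs = bl_ar g" "length ys = bl_ar g"
        "list_all2 (\<lambda>x y. (x, y) \<in> {(x, y) \<in> R \<times> R. x \<in> P \<longleftrightarrow> y \<in> P}) xs ys"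
      then show "(oper M g xs, oper M g ys) \<in> {(x, y) \<in> R \<times> R. x \<in> P \<longleftrightarrow> y \<in> P}"
        by (cases g) (auto simp: length_2_iff join meet)
    qed auto
  qed (use Pd(2) prime_filter_bt[OF P] in auto)
qed

end

section \<open>Morphisms of bounded distributive lattices\<close>

locale dist_lattice_hom = A: dist_lattice A + B: dist_lattice B
  for A :: "(bl_sym, 'a) alg" and B :: "(bl_sym, 'b) alg" +
  fixes f assumes f: "f \<in> homs bl_ar A B"
begin

lemma f_closed: "x \<in> carrier A \<Longrightarrow> f x \<in> carrier B"
  using homsD(1)[OF f] .

lemma f_tp: "f A.tp = B.tp" and f_bt: "f A.bt = B.bt"
  using homsD(2)[OF f, of "[]"] by simp_all

lemma f_binary:
  "bl_ar g = 2 \<Longrightarrow> x \<in> carrier A \<Longrightarrow> y \<in> carrier A \<Longrightarrow> f (oper A g [x, y]) = oper B g [f x, f y]"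
  using homsD(2)[OF f, of "[x, y]" g] by simp

text \<open>Having exactly two classes, separated by the bounds, passes to the preimage because
  \<open>f\<close> preserves both bounds.\<close>

lemma admissible: "admissible bl_ar A B f"
  unfolding admissible_def
proof
  fix \<psi> assume \<psi>: "\<psi> \<in> Spec bl_ar B"
  then have "\<psi> \<in> Con bl_ar B"
    by (simp add: Spec_def)
  then show "pullback A f \<psi> \<in> Spec bl_ar A"
    using B.Spec_two_class[OF \<psi>] f_closed
    by (intro A.two_class_Spec pullback_Con[OF A.alg f]) (auto simp: pullback_def f_tp f_bt)
qed

lemma GU: "fulfills_GU bl_ar A B f"
  unfolding fulfills_GU_def using A.Spec_le_eq by blast

lemma LO: "fulfills_LO bl_ar A B f"
  unfolding fulfills_LO_def
proof (intro ballI impI)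
  fix \<phi> assume \<phi>: "\<phi> \<in> Spec bl_ar A" and Ker: "Ker A B f \<subseteq> \<phi>"
  have C: "\<phi> \<in> Con bl_ar A"
    using \<phi> by (simp add: Spec_def)
  note \<phi>d = Con_refl[OF C] Con_sym[OF C] Con_trans[OF C] and two = A.Spec_two_class[OF \<phi>]
  let ?Q = "{x \<in> carrier A. (x, A.tp) \<in> \<phi>}"
  \<comment> \<open>A two-class congruence is determined by the class of the top, so it suffices to
    lift \<open>?Q\<close>.\<close>
  have Q_iff: "(x, y) \<in> \<phi> \<longleftrightarrow> (x \<in> ?Q \<longleftrightarrow> y \<in> ?Q)" if "x \<in> carrier A" "y \<in> carrier A" for x y
  proof -
    have "(x, y) \<in> \<phi> \<longleftrightarrow> ((x, A.tp) \<in> \<phi> \<longleftrightarrow> (y, A.tp) \<in> \<phi>)"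
      using two(1) two(2)[OF that(1)] two(2)[OF that(2)] by (meson \<phi>d(2,3))
    then show ?thesis
      using that by simp
  qed
  have le_Q: "y \<in> ?Q" if "x \<in> ?Q" "y \<in> carrier A" "A.le x y" for x y
    using A.Con_binary[OF C, of x A.tp y y LJoin] \<phi>d(1) that by (auto simp: A.le_def)
  have fil: "A.is_filter ?Q"
  proof (rule A.is_filterI)
    show "A.meet x y \<in> ?Q" if "x \<in> ?Q" "y \<in> ?Q" for x y
      using A.Con_binary[OF C, of x A.tp y A.tp LMeet] that by auto
  qed (use le_Q \<phi>d(1) in auto)
  moreover have "x \<in> ?Q \<or> y \<in> ?Q"
    if xy: "x \<in> carrier A" "y \<in> carrier A" "A.join x y \<in> ?Q" for x y
  proof (rule ccontr)
    assume "\<not> (x \<in> ?Q \<or> y \<in> ?Q)"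
    then have "(x, A.bt) \<in> \<phi>" "(y, A.bt) \<in> \<phi>"
      using two(2) xy by auto
    then have "(A.join x y, A.bt) \<in> \<phi>"
      using A.Con_binary[OF C, of x A.bt y A.bt LJoin] by simp
    then show False
      using xy(3) two(1) \<phi>d(2,3) by blast
  qed
  moreover have "A.bt \<notin> ?Q"
    using two(1) by simp
  then have "?Q \<noteq> carrier A"
    using A.bt_closed by blast
  ultimately have Q: "A.prime_filter ?Q"
    by (simp add: A.prime_filter_def)
  have P1: "B.is_filter {B.tp}"
    by (rule B.is_filterI) (auto simp: B.le_def)
  \<comment> \<open>Over the filter \<open>{B.tp}\<close> the premise says that \<open>f q\<close>
    lies below \<open>f a\<close>. Then \<open>A.join q a\<close> and \<open>a\<close> have the same
    image, so \<open>\<phi>\<close> identifies them as it contains the kernel.\<close>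
  have sep: "a \<in> ?Q"
    if "p \<in> {B.tp}" and q: "q \<in> ?Q" and a: "a \<in> carrier A"
      and "B.le (B.meet p (f q)) (f a)" for p q a
  proof -
    have "B.join (f q) (f a) = f a"
      using that f_closed by (auto simp: B.le_def)
    then have "(A.join q a, a) \<in> Ker A B f"
      using q a f_closed by (simp add: Ker_def pullback_def f_binary Id_on_iff)
    then have "(A.join q a, a) \<in> \<phi>"
      using Ker by blast
    moreover have "A.join q a \<in> ?Q"
      using le_Q[OF q] q a by simp
    ultimately show ?thesis
      using Q_iff[of "A.join q a" a] q a by simp
  qed
  obtain Q1 where Q1: "B.prime_filter Q1" "{x \<in> carrier A. f x \<in> Q1} = ?Q"
    by (rule prime_filter_lying_over[where f = f, OF A.lattice_monoid_axioms B.lattice_monoid_axioms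
          f_closed _ _ f_tp Q P1 sep]) (auto simp: f_binary)
  let ?\<phi>1 = "{(x, y) \<in> carrier B \<times> carrier B. x \<in> Q1 \<longleftrightarrow> y \<in> Q1}"
  have f_Q: "f x \<in> Q1 \<longleftrightarrow> x \<in> ?Q" if "x \<in> carrier A" for x
    using Q1(2) that by blast
  have "(x, y) \<in> pullback A f ?\<phi>1 \<longleftrightarrow> (x, y) \<in> \<phi>" for x y
  proof (cases "x \<in> carrier A \<and> y \<in> carrier A")
    case True
    then show ?thesis
      using Q_iff[of x y] f_Q[of x] f_Q[of y] f_closed[of x] f_closed[of y]
      by (simp add: pullback_def)
  qed (use Con_subset[OF C] in \<open>auto simp: pullback_def\<close>)
  then have "pullback A f ?\<phi>1 = \<phi>"
    by auto
  then show "\<exists>\<phi>1\<in>Spec bl_ar B. pullback A f \<phi>1 = \<phi>"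
    using B.prime_filter_Spec[OF Q1(1)] by blast
qed

end

theorem corollary8p16:
  shows
    "(\<forall>(A :: (rl_sym, 'a) alg) (B :: (rl_sym, 'b) alg).
        residuated_lattice A \<and> residuated_lattice B \<longrightarrow>
        (\<forall>f\<in>homs rl_ar A B.
           admissible rl_ar A B f \<and> fulfills_GU rl_ar A B f \<and> fulfills_LO rl_ar A B f)) \<and>
     (\<forall>(A :: (bl_sym, 'a) alg) (B :: (bl_sym, 'b) alg).
        bounded_distributive_lattice A \<and> bounded_distributive_lattice B \<longrightarrow>
        (\<forall>f\<in>homs bl_ar A B.
           admissible bl_ar A B f \<and> fulfills_GU bl_ar A B f \<and> fulfills_LO bl_ar A B f)) \<and>
     (\<forall>(ar :: 'f \<Rightarrow> nat) (V :: ('f, 'u :: infinite) alg set).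
        is_variety ar V \<and> semi_degenerate ar V \<and> filtral ar V \<longrightarrow>
        (\<forall>A\<in>V. \<forall>B\<in>V. \<forall>f\<in>homs ar A B.
           admissible ar A B f \<and> fulfills_GU ar A B f \<and> fulfills_LO ar A B f)) \<and>
     (\<forall>(ar :: 'f \<Rightarrow> nat) (V :: ('f, 'u :: infinite) alg set).
        is_variety ar V \<and> semi_degenerate ar V \<and> discriminator ar V \<longrightarrow>
        (\<forall>A\<in>V. \<forall>B\<in>V. \<forall>f\<in>homs ar A B.
           admissible ar A B f \<and> fulfills_GU ar A B f \<and> fulfills_LO ar A B f))"
proof (intro conjI allI impI ballI; (elim conjE)?)
  fix A :: "(rl_sym, 'a) alg" and B :: "(rl_sym, 'b) alg" and f
  assume "residuated_lattice A" "residuated_lattice B" "f \<in> homs rl_ar A B"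
  then interpret resid_lattice_hom A B f
    by unfold_locales
  show "admissible rl_ar A B f" "fulfills_GU rl_ar A B f" "fulfills_LO rl_ar A B f"
    using admissible GU LO .
next
  fix A :: "(bl_sym, 'a) alg" and B :: "(bl_sym, 'b) alg" and f
  assume "bounded_distributive_lattice A" "bounded_distributive_lattice B" "f \<in> homs bl_ar A B"
  then interpret dist_lattice_hom A B f
    by unfold_locales
  show "admissible bl_ar A B f" "fulfills_GU bl_ar A B f" "fulfills_LO bl_ar A B f"
    using admissible GU LO .
next
  fix ar :: "'f \<Rightarrow> nat" and V :: "('f, 'u) alg set" and A B f
  assume V: "is_variety ar V" "semi_degenerate ar V" and f: "A \<in> V" "B \<in> V" "f \<in> homs ar A B"
  {
    assume "filtral ar V"
    then show "admissible ar A B f" "fulfills_GU ar A B f" "fulfills_LO ar A B f"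
      using filtral_admissible filtral_GU filtral_LO V f by blast+
  }
  {
    assume "discriminator ar V"
    then have "filtral ar V"
      by (rule discriminator_filtral)
    then show "admissible ar A B f" "fulfills_GU ar A B f" "fulfills_LO ar A B f"
      using filtral_admissible filtral_GU filtral_LO V f by blast+
  }
qed

end
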